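(* Let $(M,\varphi,\xi,\eta,g)$ be a 3-dimensional Sasaki-like almost contact B-metric manifold, let $C(t): I\to M$ be a non-geodesic slant null curve with $\eta(\dot C)=a$ ($a$ a real constant), and suppose that the function $b(t)=g(\dot C,\varphi\dot C)$ is of class $C^1$ in $I$. Let $(C(t),\overline{\mathbf F})$ be the framed null curve with Frenet frame $\overline{\mathbf F}=\{\dot C,\overline N,\overline W\}$ described in the context, with curvatures $\bar k_1,\bar k_2$. Then both $\bar k_1$ and $\bar k_2$ are constant if and only if $b$ is constant in $I$. Moreover, for an arbitrary constant $b$ the curvatures are the constants $$\bar k_1=\epsilon_1\epsilon\left(-\sqrt{a^4+b^2}\right),\qquad \bar k_2=\epsilon_1\epsilon\left(-\frac{a^2}{2\sqrt{a^4+b^2}}\right).$$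
   Context: A 3-dimensional almost contact B-metric manifold $(M,\varphi,\xi,\eta,g)$ is a smooth 3-manifold with an endomorphism $\varphi$ of $TM$, a vector field $\xi$, a 1-form $\eta$ and a pseudo-Riemannian metric $g$ (necessarily of signature $(+,+,-)$) such that $\varphi^2X=-X+\eta(X)\xi$, $\eta(\xi)=1$, $g(\varphi X,\varphi Y)=-g(X,Y)+\eta(X)\eta(Y)$. Consequences: $\eta\circ\varphi=0$, $\varphi\xi=0$, $\eta(X)=g(X,\xi)$. With $\nabla$ the Levi-Civita connection of $g$, it is Sasaki-like if $(\nabla_X\varphi)Y=-g(X,Y)\xi-\eta(Y)X+2\eta(X)\eta(Y)\xi$ (then $\nabla_X\xi=-\varphi X$). A smooth curve $C:I\to M$ ($I$ an interval) is null if $g(\dot C,\dot C)=0$ and $\dot C\neq 0$ on $I$; it is slant if $\eta(\dot C)=a$ is constant. Put $b=g(\dot C,\varphi\dot C)$, $\dot b=db/dt$. For a slant null curve $a^4+b^2\neq 0$ everywhere. A general Frenet frame along a null curve $C$ is $\{\dot C,N,W\}$ with $g(\dot C,N)=g(W,W)=1$, $g(N,N)=g(N,W)=g(\dot C,W)=0$; for given $W$ the field $N$ is unique. The Frenet equations are $\nabla_{\dot C}\dot C=h\dot C+k_1W$, $\nabla_{\dot C}N=-hN+k_2W$, $\nabla_{\dot C}W=-k_2\dot C-k_1N$, which define the functions $h,k_1,k_2$; $k_1,k_2$ are the curvatures. The parameter $t$ is distinguished if $h=0$; a null curve with a Frenet frame for a distinguished parameter is a framed null curve. "Non-geodesic"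 means $k_1\neq0$ at every point, i.e. $-2(a^4+b^2)+a\dot b\ne 0$. The frame $\overline{\mathbf F}=\{\dot C,\overline N,\overline W\}$ of a non-geodesic slant null curve is the one with $$\overline W=\epsilon_1\epsilon\left(\frac{-b}{\sqrt{a^4+b^2}}\xi+\frac{b\dot b}{\sqrt{a^4+b^2}\,(-2(a^4+b^2)+a\dot b)}\dot C+\frac{a}{\sqrt{a^4+b^2}}\varphi\dot C\right),\qquad \epsilon,\epsilon_1\in\{1,-1\},$$ which is a unit field proportional to $\nabla_{\dot C}\dot C$, so that $\nabla_{\dot C}\dot C=\bar k_1\overline W$ ($\bar h=0$, $t$ is distinguished) and $\nabla_{\dot C}\overline N=\bar k_2\overline W$. *)

theory Defs
  imports "HOL-Analysis.Analysis" "HOL-Library.Function_Algebras"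
begin

text \<open>Pointwise scalar multiplication; tangent vectors below are families of coordinate
  vectors, i.e. functions.\<close>

instantiation "fun" :: (type, scaleR) scaleR
begin
definition scaleR_fun_def: "r *\<^sub>R f = (\<lambda>x. r *\<^sub>R f x)"
instance ..
end

instance "fun" :: (type, real_vector) real_vector
  by standard (simp_all add: scaleR_fun_def fun_eq_iff scaleR_add_right scaleR_add_left)

section \<open>Smooth maps between Euclidean spaces\<close>

text \<open>The set \<open>S\<close> is only ever an open set, or a relatively open subset of a nondegenerate real
  interval; in both cases derivatives within \<open>S\<close> are unique.\<close>

primrec Ck_on ::
  "nat \<Rightarrow> 'a::euclidean_space set \<Rightarrow> ('a \<Rightarrow> 'b::real_normed_vector) \<Rightarrow> bool"
where
  "Ck_on 0 S f \<longleftrightarrow> continuous_on S f"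
| "Ck_on (Suc k) S f \<longleftrightarrow> f differentiable_on S \<and>
     (\<forall>v. Ck_on k S (\<lambda>x. frechet_derivative f (at x within S) v))"

definition smooth_on ::
  "'a::euclidean_space set \<Rightarrow> ('a \<Rightarrow> 'b::real_normed_vector) \<Rightarrow> bool"
where
  "smooth_on S f \<longleftrightarrow> (\<forall>k. Ck_on k S f)"

section \<open>Smooth 3-manifolds\<close>

text \<open>A chart is a pair of its domain and its coordinate map (relevant on the domain only).\<close>

type_synonym 'm chart = "'m set \<times> ('m \<Rightarrow> real^3)"
type_synonym 'm atlas = "'m chart set"

definition chart_image :: "'m chart \<Rightarrow> (real^3) set" where
  "chart_image \<kappa> = snd \<kappa> ` fst \<kappa>"

definition chart_inv :: "'m chart \<Rightarrow> real^3 \<Rightarrow> 'm" where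
  "chart_inv \<kappa> = inv_into (fst \<kappa>) (snd \<kappa>)"

definition is_chart :: "'m::topological_space chart \<Rightarrow> bool" where
  "is_chart \<kappa> \<longleftrightarrow> open (fst \<kappa>) \<and> open (chart_image \<kappa>) \<and>
     homeomorphism (fst \<kappa>) (chart_image \<kappa>) (snd \<kappa>) (chart_inv \<kappa>)"

definition transition :: "'m chart \<Rightarrow> 'm chart \<Rightarrow> real^3 \<Rightarrow> real^3" where
  "transition \<kappa> \<kappa>' = snd \<kappa>' \<circ> chart_inv \<kappa>"

text \<open>The manifold is the whole type \<open>'m\<close>, with the smooth structure generated by the atlas.\<close>

definition smooth_atlas :: "'m::{t2_space,second_countable_topology} atlas \<Rightarrow> bool" where
  "smooth_atlas A \<longleftrightarrow> (\<forall>\<kappa>\<in>A. is_chart \<kappa>) \<and> (\<Union>\<kappa>\<in>A. fst \<kappa>) = UNIV \<and>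
     (\<forall>\<kappa>\<in>A. \<forall>\<kappa>'\<in>A. smooth_on (snd \<kappa> ` (fst \<kappa> \<inter> fst \<kappa>')) (transition \<kappa> \<kappa>'))"

definition charts_at :: "'m atlas \<Rightarrow> 'm \<Rightarrow> 'm chart set" where
  "charts_at A p = {\<kappa> \<in> A. p \<in> fst \<kappa>}"

definition jac :: "'m chart \<Rightarrow> 'm chart \<Rightarrow> 'm \<Rightarrow> real^3 \<Rightarrow> real^3" where
  "jac \<kappa> \<kappa>' p = frechet_derivative (transition \<kappa> \<kappa>') (at (snd \<kappa> p))"

section \<open>Tangent vectors and tensor fields\<close>

text \<open>A tangent vector at \<open>p\<close> is the family of its coordinate vectors in the charts around \<open>p\<close>,
  related to each other by the Jacobians of the coordinate changes. The value \<open>0\<close> at all other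
  charts makes the representation unique.\<close>

type_synonym 'm tvec = "'m chart \<Rightarrow> real^3"

definition tangent_space :: "'m atlas \<Rightarrow> 'm \<Rightarrow> 'm tvec set" where
  "tangent_space A p = {v.
     (\<forall>\<kappa>\<in>charts_at A p. \<forall>\<kappa>'\<in>charts_at A p. v \<kappa>' = jac \<kappa> \<kappa>' p (v \<kappa>)) \<and>
     (\<forall>\<kappa>. \<kappa> \<notin> charts_at A p \<longrightarrow> v \<kappa> = 0)}"

text \<open>The tangent vector \<open>\<Sum>\<^sub>i X\<^sub>i \<partial>/\<partial>x\<^sub>i\<close> at \<open>p\<close>, where \<open>x\<close> are the coordinates of \<open>\<kappa>\<close>.\<close>

definition tvec_of :: "'m atlas \<Rightarrow> 'm chart \<Rightarrow> 'm \<Rightarrow> real^3 \<Rightarrow> 'm tvec" where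
  "tvec_of A \<kappa> p X = (\<lambda>\<kappa>'. if \<kappa>' \<in> charts_at A p then jac \<kappa> \<kappa>' p X else 0)"

definition linear_on_subspace ::
  "'a::real_vector set \<Rightarrow> ('a \<Rightarrow> 'b::real_vector) \<Rightarrow> bool"
where
  "linear_on_subspace T f \<longleftrightarrow>
     (\<forall>X\<in>T. \<forall>Y\<in>T. \<forall>r s. f (r *\<^sub>R X + s *\<^sub>R Y) = r *\<^sub>R f X + s *\<^sub>R f Y)"

definition vector_field :: "'m atlas \<Rightarrow> ('m \<Rightarrow> 'm tvec) \<Rightarrow> bool" where
  "vector_field A \<xi> \<longleftrightarrow> (\<forall>p. \<xi> p \<in> tangent_space A p) \<and>
     (\<forall>\<kappa>\<in>A. smooth_on (chart_image \<kappa>) (\<lambda>x. \<xi> (chart_inv \<kappa> x) \<kappa>))"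

definition one_form :: "'m atlas \<Rightarrow> ('m \<Rightarrow> 'm tvec \<Rightarrow> real) \<Rightarrow> bool" where
  "one_form A \<eta> \<longleftrightarrow> (\<forall>p. linear_on_subspace (tangent_space A p) (\<eta> p)) \<and>
     (\<forall>\<kappa>\<in>A. \<forall>X. smooth_on (chart_image \<kappa>)
        (\<lambda>x. \<eta> (chart_inv \<kappa> x) (tvec_of A \<kappa> (chart_inv \<kappa> x) X)))"

definition endo_coord ::
  "'m atlas \<Rightarrow> ('m \<Rightarrow> 'm tvec \<Rightarrow> 'm tvec) \<Rightarrow> 'm chart \<Rightarrow> real^3 \<Rightarrow> real^3 \<Rightarrow> real^3"
where
  "endo_coord A \<phi> \<kappa> x X = \<phi> (chart_inv \<kappa> x) (tvec_of A \<kappa> (chart_inv \<kappa> x) X) \<kappa>"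

definition tangent_endomorphism :: "'m atlas \<Rightarrow> ('m \<Rightarrow> 'm tvec \<Rightarrow> 'm tvec) \<Rightarrow> bool" where
  "tangent_endomorphism A \<phi> \<longleftrightarrow>
     (\<forall>p. \<phi> p ` tangent_space A p \<subseteq> tangent_space A p \<and>
          linear_on_subspace (tangent_space A p) (\<phi> p)) \<and>
     (\<forall>\<kappa>\<in>A. \<forall>X. smooth_on (chart_image \<kappa>) (\<lambda>x. endo_coord A \<phi> \<kappa> x X))"

definition metric_coord ::
  "'m atlas \<Rightarrow> ('m \<Rightarrow> 'm tvec \<Rightarrow> 'm tvec \<Rightarrow> real) \<Rightarrow>
    'm chart \<Rightarrow> real^3 \<Rightarrow> real^3 \<Rightarrow> real^3 \<Rightarrow> real"
where
  "metric_coord A g \<kappa> x X Y =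
     g (chart_inv \<kappa> x) (tvec_of A \<kappa> (chart_inv \<kappa> x) X) (tvec_of A \<kappa> (chart_inv \<kappa> x) Y)"

text \<open>Constancy of the signature is not required here: it is automatic on connected components,
  and the B-metric condition below forces the signature \<open>(+,+,-)\<close>.\<close>

definition pseudo_riemannian_metric ::
  "'m atlas \<Rightarrow> ('m \<Rightarrow> 'm tvec \<Rightarrow> 'm tvec \<Rightarrow> real) \<Rightarrow> bool"
where
  "pseudo_riemannian_metric A g \<longleftrightarrow>
     (\<forall>p. (\<forall>X\<in>tangent_space A p. linear_on_subspace (tangent_space A p) (g p X)) \<and>
          (\<forall>X\<in>tangent_space A p. \<forall>Y\<in>tangent_space A p. g p X Y = g p Y X) \<and>
          (\<forall>X\<in>tangent_space A p. (\<forall>Y\<in>tangent_space A p. g p X Y = 0) \<longrightarrow> X = 0)) \<and>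
     (\<forall>\<kappa>\<in>A. \<forall>X Y. smooth_on (chart_image \<kappa>) (\<lambda>x. metric_coord A g \<kappa> x X Y))"

section \<open>The Levi-Civita connection\<close>

text \<open>A connection is given by its Christoffel symbols in each chart: \<open>\<nabla>\<^sub>X Y\<close> has the coordinate
  expression \<open>D\<^sub>X Y + \<Gamma>(X,Y)\<close>. Independence of the chart is the usual inhomogeneous
  transformation law \<open>\<Gamma>'(JX,JY) = J(\<Gamma>(X,Y)) - D\<^sup>2\<tau>(X,Y)\<close> under the coordinate change \<open>\<tau>\<close> with
  Jacobian \<open>J\<close>.\<close>

type_synonym 'm connection = "'m chart \<Rightarrow> real^3 \<Rightarrow> real^3 \<Rightarrow> real^3 \<Rightarrow> real^3"

definition affine_connection :: "'m atlas \<Rightarrow> 'm connection \<Rightarrow> bool" where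
  "affine_connection A \<Gamma> \<longleftrightarrow>
     (\<forall>\<kappa>\<in>A. (\<forall>x\<in>chart_image \<kappa>. bilinear (\<Gamma> \<kappa> x)) \<and>
            (\<forall>X Y. smooth_on (chart_image \<kappa>) (\<lambda>x. \<Gamma> \<kappa> x X Y))) \<and>
     (\<forall>\<kappa>\<in>A. \<forall>\<kappa>'\<in>A. \<forall>p\<in>fst \<kappa> \<inter> fst \<kappa>'. \<forall>X Y.
        \<Gamma> \<kappa>' (snd \<kappa>' p) (jac \<kappa> \<kappa>' p X) (jac \<kappa> \<kappa>' p Y) =
          jac \<kappa> \<kappa>' p (\<Gamma> \<kappa> (snd \<kappa> p) X Y) -
          frechet_derivative (\<lambda>x. frechet_derivative (transition \<kappa> \<kappa>') (at x) Y) (at (snd \<kappa> p)) X)"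

text \<open>Torsion-free and metric, both conditions being written for coordinate fields (which
  commute): \<open>\<nabla>\<^sub>X Y = \<nabla>\<^sub>Y X\<close> and \<open>Z g(X,Y) = g(\<nabla>\<^sub>Z X,Y) + g(X,\<nabla>\<^sub>Z Y)\<close>.\<close>

definition levi_civita ::
  "'m atlas \<Rightarrow> ('m \<Rightarrow> 'm tvec \<Rightarrow> 'm tvec \<Rightarrow> real) \<Rightarrow> 'm connection \<Rightarrow> bool"
where
  "levi_civita A g \<Gamma> \<longleftrightarrow> affine_connection A \<Gamma> \<and>
     (\<forall>\<kappa>\<in>A. \<forall>x\<in>chart_image \<kappa>.
        (\<forall>X Y. \<Gamma> \<kappa> x X Y = \<Gamma> \<kappa> x Y X) \<and>
        (\<forall>X Y Z. frechet_derivative (\<lambda>y. metric_coord A g \<kappa> y X Y) (at x) Z =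
           metric_coord A g \<kappa> x (\<Gamma> \<kappa> x Z X) Y + metric_coord A g \<kappa> x X (\<Gamma> \<kappa> x Z Y)))"

text \<open>The tensor \<open>(\<nabla>\<^sub>X \<phi>) Y = \<nabla>\<^sub>X (\<phi> Y) - \<phi> (\<nabla>\<^sub>X Y)\<close> at \<open>p\<close>, evaluated in each chart by extending
  \<open>Y\<close> with constant coordinates.\<close>

definition nabla_endo ::
  "'m atlas \<Rightarrow> 'm connection \<Rightarrow> ('m \<Rightarrow> 'm tvec \<Rightarrow> 'm tvec) \<Rightarrow> 'm \<Rightarrow> 'm tvec \<Rightarrow> 'm tvec \<Rightarrow> 'm tvec"
where
  "nabla_endo A \<Gamma> \<phi> p X Y = (\<lambda>\<kappa>. if \<kappa> \<in> charts_at A p then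
       frechet_derivative (\<lambda>y. endo_coord A \<phi> \<kappa> y (Y \<kappa>)) (at (snd \<kappa> p)) (X \<kappa>)
       + \<Gamma> \<kappa> (snd \<kappa> p) (X \<kappa>) (endo_coord A \<phi> \<kappa> (snd \<kappa> p) (Y \<kappa>))
       - endo_coord A \<phi> \<kappa> (snd \<kappa> p) (\<Gamma> \<kappa> (snd \<kappa> p) (X \<kappa>) (Y \<kappa>))
     else 0)"

section \<open>Sasaki-like almost contact B-metric manifolds\<close>

definition almost_contact_B_metric ::
  "'m::{t2_space,second_countable_topology} atlas \<Rightarrow> ('m \<Rightarrow> 'm tvec \<Rightarrow> 'm tvec) \<Rightarrow>
    ('m \<Rightarrow> 'm tvec) \<Rightarrow> ('m \<Rightarrow> 'm tvec \<Rightarrow> real) \<Rightarrow> ('m \<Rightarrow> 'm tvec \<Rightarrow> 'm tvec \<Rightarrow> real) \<Rightarrow> bool"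
where
  "almost_contact_B_metric A \<phi> \<xi> \<eta> g \<longleftrightarrow>
     smooth_atlas A \<and> tangent_endomorphism A \<phi> \<and> vector_field A \<xi> \<and> one_form A \<eta> \<and>
     pseudo_riemannian_metric A g \<and>
     (\<forall>p. \<eta> p (\<xi> p) = 1 \<and>
        (\<forall>X\<in>tangent_space A p. \<phi> p (\<phi> p X) = - X + \<eta> p X *\<^sub>R \<xi> p) \<and>
        (\<forall>X\<in>tangent_space A p. \<forall>Y\<in>tangent_space A p.
           g p (\<phi> p X) (\<phi> p Y) = - g p X Y + \<eta> p X * \<eta> p Y))"

definition sasaki_like ::
  "'m atlas \<Rightarrow> ('m \<Rightarrow> 'm tvec \<Rightarrow> 'm tvec) \<Rightarrow> ('m \<Rightarrow> 'm tvec) \<Rightarrow> ('m \<Rightarrow> 'm tvec \<Rightarrow> real) \<Rightarrow>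
    ('m \<Rightarrow> 'm tvec \<Rightarrow> 'm tvec \<Rightarrow> real) \<Rightarrow> 'm connection \<Rightarrow> bool"
where
  "sasaki_like A \<phi> \<xi> \<eta> g \<Gamma> \<longleftrightarrow>
     (\<forall>p. \<forall>X\<in>tangent_space A p. \<forall>Y\<in>tangent_space A p.
        nabla_endo A \<Gamma> \<phi> p X Y =
          - (g p X Y *\<^sub>R \<xi> p) - \<eta> p Y *\<^sub>R X + (2 * \<eta> p X * \<eta> p Y) *\<^sub>R \<xi> p)"

section \<open>Curves and fields along curves\<close>

definition smooth_curve :: "'m::topological_space atlas \<Rightarrow> real set \<Rightarrow> (real \<Rightarrow> 'm) \<Rightarrow> bool" where
  "smooth_curve A I C \<longleftrightarrow> is_interval I \<and> interior I \<noteq> {} \<and> continuous_on I C \<and>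
     (\<forall>\<kappa>\<in>A. smooth_on {t \<in> I. C t \<in> fst \<kappa>} (\<lambda>t. snd \<kappa> (C t)))"

definition velocity :: "'m atlas \<Rightarrow> real set \<Rightarrow> (real \<Rightarrow> 'm) \<Rightarrow> real \<Rightarrow> 'm tvec" where
  "velocity A I C t = (\<lambda>\<kappa>. if \<kappa> \<in> charts_at A (C t)
     then vector_derivative (\<lambda>s. snd \<kappa> (C s)) (at t within I) else 0)"

definition field_along ::
  "'m atlas \<Rightarrow> real set \<Rightarrow> (real \<Rightarrow> 'm) \<Rightarrow> (real \<Rightarrow> 'm tvec) \<Rightarrow> bool"
where
  "field_along A I C V \<longleftrightarrow> (\<forall>t\<in>I. V t \<in> tangent_space A (C t)) \<and>
     (\<forall>\<kappa>\<in>A. smooth_on {t \<in> I. C t \<in> fst \<kappa>} (\<lambda>t. V t \<kappa>))"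

text \<open>The covariant derivative along the curve, \<open>\<nabla>\<^bsub>C'\<^esub> V = V' + \<Gamma>(C',V)\<close> in coordinates.\<close>

definition nabla_along ::
  "'m atlas \<Rightarrow> 'm connection \<Rightarrow> real set \<Rightarrow> (real \<Rightarrow> 'm) \<Rightarrow> (real \<Rightarrow> 'm tvec) \<Rightarrow> real \<Rightarrow> 'm tvec"
where
  "nabla_along A \<Gamma> I C V t = (\<lambda>\<kappa>. if \<kappa> \<in> charts_at A (C t) then
       vector_derivative (\<lambda>s. V s \<kappa>) (at t within I)
       + \<Gamma> \<kappa> (snd \<kappa> (C t)) (velocity A I C t \<kappa>) (V t \<kappa>)
     else 0)"

definition null_curve ::
  "'m::topological_space atlas \<Rightarrow> ('m \<Rightarrow> 'm tvec \<Rightarrow> 'm tvec \<Rightarrow> real) \<Rightarrow> real set \<Rightarrow> (real \<Rightarrow> 'm) \<Rightarrow> bool"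
where
  "null_curve A g I C \<longleftrightarrow> smooth_curve A I C \<and>
     (\<forall>t\<in>I. g (C t) (velocity A I C t) (velocity A I C t) = 0 \<and> velocity A I C t \<noteq> 0)"

definition slant_curve ::
  "'m atlas \<Rightarrow> ('m \<Rightarrow> 'm tvec \<Rightarrow> real) \<Rightarrow> real set \<Rightarrow> (real \<Rightarrow> 'm) \<Rightarrow> real \<Rightarrow> bool"
where
  "slant_curve A \<eta> I C a \<longleftrightarrow> (\<forall>t\<in>I. \<eta> (C t) (velocity A I C t) = a)"

section \<open>Frenet frames of null curves\<close>

definition frenet_frame ::
  "'m atlas \<Rightarrow> ('m \<Rightarrow> 'm tvec \<Rightarrow> 'm tvec \<Rightarrow> real) \<Rightarrow> real set \<Rightarrow> (real \<Rightarrow> 'm) \<Rightarrow>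
    (real \<Rightarrow> 'm tvec) \<Rightarrow> (real \<Rightarrow> 'm tvec) \<Rightarrow> bool"
where
  "frenet_frame A g I C N W \<longleftrightarrow> field_along A I C N \<and> field_along A I C W \<and>
     (\<forall>t\<in>I. g (C t) (velocity A I C t) (N t) = 1 \<and> g (C t) (W t) (W t) = 1 \<and>
            g (C t) (N t) (N t) = 0 \<and> g (C t) (N t) (W t) = 0 \<and>
            g (C t) (velocity A I C t) (W t) = 0)"

definition frenet_equations ::
  "'m atlas \<Rightarrow> 'm connection \<Rightarrow> real set \<Rightarrow> (real \<Rightarrow> 'm) \<Rightarrow> (real \<Rightarrow> 'm tvec) \<Rightarrow> (real \<Rightarrow> 'm tvec) \<Rightarrow>
    (real \<Rightarrow> real) \<Rightarrow> (real \<Rightarrow> real) \<Rightarrow> (real \<Rightarrow> real) \<Rightarrow> bool"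
where
  "frenet_equations A \<Gamma> I C N W h k1 k2 \<longleftrightarrow> (\<forall>t\<in>I.
     nabla_along A \<Gamma> I C (velocity A I C) t = h t *\<^sub>R velocity A I C t + k1 t *\<^sub>R W t \<and>
     nabla_along A \<Gamma> I C N t = - (h t *\<^sub>R N t) + k2 t *\<^sub>R W t \<and>
     nabla_along A \<Gamma> I C W t = - (k2 t *\<^sub>R velocity A I C t) - k1 t *\<^sub>R N t)"

text \<open>The parameter is distinguished, i.e. \<open>h = 0\<close>; \<open>k1\<close> and \<open>k2\<close> are the curvatures.\<close>

definition framed_null_curve ::
  "'m::topological_space atlas \<Rightarrow> ('m \<Rightarrow> 'm tvec \<Rightarrow> 'm tvec \<Rightarrow> real) \<Rightarrow> 'm connection \<Rightarrow>
    real set \<Rightarrow> (real \<Rightarrow> 'm) \<Rightarrow> (real \<Rightarrow> 'm tvec) \<Rightarrow> (real \<Rightarrow> 'm tvec) \<Rightarrow>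
    (real \<Rightarrow> real) \<Rightarrow> (real \<Rightarrow> real) \<Rightarrow> bool"
where
  "framed_null_curve A g \<Gamma> I C N W k1 k2 \<longleftrightarrow>
     null_curve A g I C \<and> frenet_frame A g I C N W \<and>
     frenet_equations A \<Gamma> I C N W (\<lambda>t. 0) k1 k2"

text \<open>The first curvature vanishes nowhere. This does not depend on the Frenet frame, since
  \<open>k1\<^sup>2 = g (\<nabla>\<^bsub>C'\<^esub> C') (\<nabla>\<^bsub>C'\<^esub> C')\<close>.\<close>

definition non_geodesic ::
  "'m atlas \<Rightarrow> ('m \<Rightarrow> 'm tvec \<Rightarrow> 'm tvec \<Rightarrow> real) \<Rightarrow> 'm connection \<Rightarrow>
    real set \<Rightarrow> (real \<Rightarrow> 'm) \<Rightarrow> bool"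
where
  "non_geodesic A g \<Gamma> I C \<longleftrightarrow> (\<exists>N W h k1 k2. frenet_frame A g I C N W \<and>
     frenet_equations A \<Gamma> I C N W h k1 k2 \<and> (\<forall>t\<in>I. k1 t \<noteq> 0))"

end

theory Submission
  imports Defs
begin

text \<open>
  Put \<open>\<sigma> = \<epsilon>\<^sub>1 \<epsilon>\<close>, \<open>s = sqrt (a\<^sup>4 + b\<^sup>2)\<close>, and write \<open>C'\<close> for the velocity and \<open>\<nabla>\<close> for the covariant derivative
  along the curve. On a Sasaki-like manifold \<open>\<nabla> \<xi> = - \<phi> C'\<close> (\<open>has_cov_xi\<close>), and along a slant null curve with
  \<open>\<nabla> C' = k\<^sub>1 W\<close> the field \<open>\<phi> C'\<close> has the derivative \<open>- a C' + 2 a\<^sup>2 \<xi> + k\<^sub>1 \<phi> W\<close>. Hence everything built from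
  \<open>C'\<close>, \<open>\<xi>\<close>, \<open>\<phi> C'\<close> can be differentiated explicitly.

  \<^item> Differentiating \<open>\<eta> C' = a\<close> and \<open>b = g (C', \<phi> C')\<close> yields \<open>k\<^sub>1 \<eta> W = b\<close> and \<open>b' = 2 k\<^sub>1 g (W, \<phi> C') + 2 a\<^sup>3\<close>.
    With the given expression of \<open>W\<close> these determine the first curvature,
    \<open>2 s k\<^sub>1 = \<sigma> (a b' - 2 s\<^sup>2)\<close> (\<open>first_curvature_of_slant_null_curve\<close>).

  \<^item> If \<open>b\<close> is constant, then \<open>k\<^sub>1 = - \<sigma> s\<close>, and \<open>\<nabla> W = (\<sigma>/s) (b \<phi> C' + a\<^sup>3 \<xi>)\<close> has square length \<open>a\<^sup>2\<close>. By the Frenet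
    equations this square length is \<open>2 k\<^sub>1 k\<^sub>2\<close>, which gives \<open>k\<^sub>2\<close> (\<open>curvature_product_of_constant_b\<close>).

  \<^item> Conversely let \<open>k\<^sub>1\<close> and \<open>k\<^sub>2\<close> be constant. If \<open>a = 0\<close>, the first curvature shows \<open>b\<^sup>2 = k\<^sub>1\<^sup>2\<close>. If \<open>a \<noteq> 0\<close>,
    differentiating \<open>\<eta> W = b/k\<^sub>1\<close> and using \<open>1 = g (\<xi>, \<xi>) = 2 a \<eta> N + (\<eta> W)\<^sup>2\<close> gives
    \<open>3 a b' - 2 a\<^sup>4 = - 2 k\<^sub>1 k\<^sub>2 a\<^sup>2 - k\<^sub>1\<^sup>2 + b\<^sup>2\<close> (\<open>curvature_relation_if_k1_constant\<close>). Eliminating \<open>b'\<close> with the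
    formula for \<open>k\<^sub>1\<close> leaves \<open>5 s\<^sup>2 + 6 \<sigma> k\<^sub>1 s = const\<close>. In either case \<open>b\<close> takes only finitely many values, and
    being continuous on an interval it is constant (\<open>b_constant_if_curvatures_constant\<close>).

  These are identities between tangent vectors at one parameter and involve first derivatives at that
  parameter only. They are therefore proved in a single chart around the point, as identities between
  coordinate vectors, and their scalar consequences are transferred to the manifold.
\<close>

section \<open>Almost contact B-metric structures on a vector space\<close>

text \<open>The structure that an almost contact B-metric manifold induces on a single tangent space. The
  axioms are imposed on the whole vector space, so that the coordinate expressions in a chart can be
  used as an instance without any relativisation to a subspace.\<close>

locale B_metric_space =
  fixes \<phi> :: "'v::real_vector \<Rightarrow> 'v" and \<xi> :: 'v and \<eta> :: "'v \<Rightarrow> real" and g :: "'v \<Rightarrow> 'v \<Rightarrow> real"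
  assumes linear_phi: "linear \<phi>" and linear_eta: "linear \<eta>" and bilinear_g: "bilinear g"
    and g_sym: "g X Y = g Y X"
    and phi_phi: "\<phi> (\<phi> X) = - X + \<eta> X *\<^sub>R \<xi>"
    and eta_xi: "\<eta> \<xi> = 1"
    and g_phi_phi: "g (\<phi> X) (\<phi> Y) = - g X Y + \<eta> X * \<eta> Y"
begin

lemmas phi_simps = linear_add[OF linear_phi] linear_diff[OF linear_phi] linear_neg[OF linear_phi]
  linear_scale[OF linear_phi] linear_0[OF linear_phi]
lemmas eta_simps = linear_add[OF linear_eta] linear_diff[OF linear_eta] linear_neg[OF linear_eta]
  linear_scale[OF linear_eta] linear_0[OF linear_eta]
lemmas g_simps = bilinear_ladd[OF bilinear_g] bilinear_radd[OF bilinear_g]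
  bilinear_lsub[OF bilinear_g] bilinear_rsub[OF bilinear_g]
  bilinear_lmul[OF bilinear_g] bilinear_rmul[OF bilinear_g]
  bilinear_lneg[OF bilinear_g] bilinear_rneg[OF bilinear_g]
  bilinear_lzero[OF bilinear_g] bilinear_rzero[OF bilinear_g]

lemma xi_nonzero: "\<xi> \<noteq> 0"
  using eta_xi eta_simps by force

text \<open>Since \<open>\<phi>\<^sup>2\<close> kills \<open>\<xi>\<close> and acts as \<open>- id\<close> modulo \<open>\<xi>\<close>, the vector \<open>\<phi> \<xi>\<close> is a multiple \<open>r \<xi>\<close>, and then
  \<open>r\<^sup>2 \<xi> = \<phi>\<^sup>2 \<xi> = 0\<close>.\<close>

lemma phi_xi: "\<phi> \<xi> = 0"
proof -
  have phi2: "\<phi> (\<phi> \<xi>) = 0"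
    using phi_phi[of \<xi>] eta_xi by simp
  define r where "r = \<eta> (\<phi> \<xi>)"
  have r: "\<phi> \<xi> = r *\<^sub>R \<xi>"
    using phi_phi[of "\<phi> \<xi>"] phi2 phi_simps(5) by (simp add: r_def)
  have "(r * r) *\<^sub>R \<xi> = 0"
    using phi2 r phi_simps(4) by simp
  then show ?thesis
    using r xi_nonzero by simp
qed

lemma eta_phi: "\<eta> (\<phi> X) = 0"
proof -
  have "\<phi> (\<phi> (\<phi> X)) = - \<phi> X"
    unfolding phi_phi[of X] by (simp add: phi_simps phi_xi)
  then have "\<eta> (\<phi> X) *\<^sub>R \<xi> = 0"
    using phi_phi[of "\<phi> X"] by simp
  then show ?thesis
    using xi_nonzero by simp
qed

lemma g_xi: "g X \<xi> = \<eta> X"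
  using g_phi_phi[of X \<xi>] by (simp add: phi_xi g_simps eta_xi)

lemma phi_symmetric: "g (\<phi> X) Y = g X (\<phi> Y)"
proof -
  have "g (\<phi> (\<phi> X)) (\<phi> Y) = - g (\<phi> X) Y"
    using g_phi_phi[of "\<phi> X" Y] by (simp add: eta_phi)
  moreover have "g (\<phi> (\<phi> X)) (\<phi> Y) = - g X (\<phi> Y) + \<eta> X * g (\<phi> Y) \<xi>"
    unfolding phi_phi[of X] by (simp add: g_simps g_sym[of \<xi>])
  ultimately show ?thesis
    by (simp add: g_xi eta_phi)
qed

lemma phi_eq_0_imp:
  assumes "\<phi> X = 0" and "\<eta> X = 0"
  shows "X = 0"
  using phi_phi[of X] assms by (simp add: phi_simps)

lemma null_products:
  assumes "g v v = 0" and "\<eta> v = a" and "g v (\<phi> v) = b"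
  shows "g v \<xi> = a" "g \<xi> v = a" "g (\<phi> v) v = b" "g (\<phi> v) (\<phi> v) = a\<^sup>2" "g \<xi> \<xi> = 1"
    "g (\<phi> v) \<xi> = 0" "g \<xi> (\<phi> v) = 0"
  using assms g_sym[of \<xi>] g_sym[of "\<phi> v" v]
  by (simp_all add: g_xi eta_xi eta_phi g_phi_phi power2_eq_square)

text \<open>Pointwise determination of \<open>k = k\<^sub>1\<close>. The assumptions \<open>d_eta\<close> and \<open>d_b\<close> are what differentiating
  \<open>\<eta> C' = a\<close> and \<open>b = g (C', \<phi> C')\<close> along the curve gives when \<open>\<nabla> C' = k W\<close>. With
  \<open>Q = - 2 s\<^sup>2 + a b'\<close>, inserting \<open>W\<close> turns them into
  \<open>b (2 s k \<sigma> - Q) = 0\<close> and \<open>(b' - 2 a\<^sup>3) (2 s k \<sigma> - Q) = 0\<close>; if the second factor were nonzero, then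
  \<open>b = 0\<close> and \<open>b' = 2 a\<^sup>3\<close>, which forces \<open>Q = 0\<close>.

  The inequalities \<open>s \<noteq> 0\<close> and \<open>Q \<noteq> 0\<close> are consequences of the formula for \<open>W\<close> as a total expression,
  in which division by zero gives zero: \<open>s = 0\<close> would make \<open>W\<close> vanish, contradicting
  \<open>g W W = 1\<close>; and \<open>Q = 0\<close> would remove the \<open>v\<close> component of \<open>W\<close>, whereupon \<open>b = 0\<close> forces \<open>k = 0\<close>, while
  \<open>b \<noteq> 0\<close> forces \<open>b' = 0\<close> and hence \<open>Q = - 2 s\<^sup>2 \<noteq> 0\<close>.\<close>

lemma first_curvature_of_slant_null_curve:
  assumes v: "g v v = 0" "\<eta> v = a" "g v (\<phi> v) = b" and \<sigma>: "\<sigma>\<^sup>2 = 1"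
    and s: "s = sqrt (a^4 + b\<^sup>2)"
    and W: "W = \<sigma> *\<^sub>R ((- b / s) *\<^sub>R \<xi>
         + (b * b' / (s * (- 2 * (a^4 + b\<^sup>2) + a * b'))) *\<^sub>R v + (a / s) *\<^sub>R \<phi> v)"
    and unit: "g W W = 1" and k: "k \<noteq> 0"
    and d_eta: "k * \<eta> W = b" and d_b: "b' = 2 * k * g W (\<phi> v) + 2 * a^3"
  shows "s > 0" "2 * s * k = \<sigma> * (- 2 * s\<^sup>2 + a * b')"
proof -
  show s_pos: "s > 0"
  proof (rule ccontr)
    assume "\<not> s > 0"
    moreover have "s \<ge> 0"
      using s by simp
    ultimately have "s = 0"
      by linarith
    then have "W = 0"
      using W by simp
    then show False
      using unit by (simp add: g_simps)
  qed
  have s2: "s\<^sup>2 = a^4 + b\<^sup>2"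
    using s by simp
  define Q where "Q = - 2 * s\<^sup>2 + a * b'"
  define c where "c = b * b' / (s * Q)"
  have W': "W = \<sigma> *\<^sub>R ((- b / s) *\<^sub>R \<xi> + c *\<^sub>R v + (a / s) *\<^sub>R \<phi> v)"
    using W by (simp add: c_def Q_def s2)
  have eta_W: "\<eta> W = \<sigma> * (c * a - b / s)"
    unfolding W' using v by (simp add: eta_simps eta_xi eta_phi algebra_simps)
  have W_phi_v: "g W (\<phi> v) = \<sigma> * (c * b + a^3 / s)"
    unfolding W' using v
    by (simp add: g_simps null_products[OF v] power2_eq_square power3_eq_cube)
  have Q: "Q \<noteq> 0"
  proof
    assume Q0: "Q = 0"
    then have c0: "c = 0" by (simp add: c_def)
    have 1: "k * \<sigma> * b = - b * s"
      using d_eta s_pos unfolding eta_W c0 by (simp add: field_simps)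
    have 2: "(b' - 2 * a^3) * s = 2 * (k * \<sigma>) * a^3"
      using d_b s_pos unfolding W_phi_v c0 by (simp add: field_simps)
    have 3: "a * b' = 2 * s\<^sup>2"
      using Q0 by (simp add: Q_def)
    show False
    proof (cases "b = 0")
      case True
      have a: "a \<noteq> 0"
        using True s2 s_pos by auto
      have "a * (b' - 2 * a^3) = 0"
        using 3 s2 True by (simp add: algebra_simps power_eq_if)
      then have "(k * \<sigma>) * a^3 = 0"
        using 2 a by simp
      then show False
        using a k \<sigma> by auto
    next
      case False
      then have ks: "k * \<sigma> = - s"
        using 1 mult_cancel_right[of "k * \<sigma>" b "- s"] by (simp add: mult.commute)
      then have "(b' - 2 * a^3) * s = (- 2 * a^3) * s"
        using 2 by simp
      then have "b' * s = 0"
        by (simp add: algebra_simps)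
      then show False
        using 3 s_pos by simp
    qed
  qed
  have ca: "c * a - b / s = 2 * b * s / Q"
  proof -
    have "c * a - b / s = b * (a * b' - Q) / (s * Q)"
      using Q s_pos by (simp add: c_def field_simps)
    also have "\<dots> = 2 * b * s / Q"
      using Q s_pos by (simp add: Q_def field_simps power2_eq_square)
    finally show ?thesis .
  qed
  have cb: "c * b + a^3 / s = s * (b' - 2 * a^3) / Q"
  proof -
    have "c * b + a^3 / s = (b\<^sup>2 * b' + a^3 * Q) / (s * Q)"
      using Q s_pos by (simp add: c_def field_simps power2_eq_square)
    also have "b\<^sup>2 * b' + a^3 * Q = s\<^sup>2 * (b' - 2 * a^3)"
      unfolding Q_def s2 by (simp add: algebra_simps power_eq_if)
    also have "s\<^sup>2 * (b' - 2 * a^3) / (s * Q) = s * (b' - 2 * a^3) / Q"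
      using s_pos by (simp add: power2_eq_square)
    finally show ?thesis .
  qed
  have 1: "b * (2 * s * k * \<sigma> - Q) = 0"
    using d_eta Q unfolding eta_W ca by (simp add: field_simps)
  have 2: "(b' - 2 * a^3) * (2 * s * k * \<sigma> - Q) = 0"
    using d_b Q unfolding W_phi_v cb by (simp add: field_simps)
  have "2 * s * k * \<sigma> = Q"
  proof (rule ccontr)
    assume "2 * s * k * \<sigma> \<noteq> Q"
    then have "b = 0" "b' = 2 * a^3"
      using 1 2 by auto
    then have "Q = 0"
      unfolding Q_def s2 by (simp add: power_eq_if)
    then show False using Q by simp
  qed
  then have "2 * s * k * \<sigma>\<^sup>2 = \<sigma> * Q"
    by (simp add: power2_eq_square)
  then show "2 * s * k = \<sigma> * (- 2 * s\<^sup>2 + a * b')"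
    using \<sigma> by (simp add: Q_def)
qed

text \<open>When \<open>b\<close> is constant, \<open>W\<close> is a combination of \<open>\<xi>\<close> and \<open>\<phi> C'\<close> with constant coefficients, and the
  right-hand side of \<open>DW\<close> is its covariant derivative. It simplifies to
  \<open>(\<sigma>/s) (b \<phi> C' + a\<^sup>3 \<xi>)\<close>, whose square length is \<open>a\<^sup>2\<close>; by the Frenet equation the
  square length is also \<open>2 k\<^sub>1 k\<^sub>2\<close>. Comparing square lengths avoids determining \<open>N\<close>.\<close>

lemma curvature_product_of_constant_b:
  assumes v: "g v v = 0" "\<eta> v = a" "g v (\<phi> v) = b" and \<sigma>: "\<sigma>\<^sup>2 = 1"
    and s: "s > 0" "s\<^sup>2 = a^4 + b\<^sup>2" and k1: "k1 = - \<sigma> * s"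
    and W: "W = (\<sigma> * (- b / s)) *\<^sub>R \<xi> + (\<sigma> * (a / s)) *\<^sub>R \<phi> v"
    and DW: "- (k2 *\<^sub>R v) - k1 *\<^sub>R N =
      (\<sigma> * (- b / s)) *\<^sub>R (- \<phi> v)
      + (\<sigma> * (a / s)) *\<^sub>R (- (a *\<^sub>R v) + (2 * a\<^sup>2) *\<^sub>R \<xi> + k1 *\<^sub>R \<phi> W)"
    and N: "g v N = 1" "g N N = 0"
  shows "2 * k1 * k2 = a\<^sup>2"
proof -
  have phi_W: "\<phi> W = (\<sigma> * (a / s)) *\<^sub>R (- v + a *\<^sub>R \<xi>)"
    unfolding W using v by (simp add: phi_simps phi_xi phi_phi)
  have "- (k2 *\<^sub>R v) - k1 *\<^sub>R N = (\<sigma> * (b / s)) *\<^sub>R \<phi> v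
      + (- \<sigma> * a\<^sup>2 / s - k1 * (\<sigma> * (a / s))\<^sup>2) *\<^sub>R v
      + (2 * a^3 * \<sigma> / s + k1 * a * (\<sigma> * (a / s))\<^sup>2) *\<^sub>R \<xi>"
    unfolding DW phi_W
    by (simp add: scaleR_add_right scaleR_diff_right scaleR_add_left scaleR_diff_left
        power2_eq_square power3_eq_cube mult_ac)
  also have "- \<sigma> * a\<^sup>2 / s - k1 * (\<sigma> * (a / s))\<^sup>2 = 0"
    unfolding k1 power_mult_distrib \<sigma> using s(1) by (simp add: field_simps power2_eq_square)
  also have "2 * a^3 * \<sigma> / s + k1 * a * (\<sigma> * (a / s))\<^sup>2 = \<sigma> * a^3 / s"
    unfolding k1 power_mult_distrib \<sigma> using s(1)
    by (simp add: field_simps power2_eq_square power3_eq_cube)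
  finally have DW': "- (k2 *\<^sub>R v) - k1 *\<^sub>R N = (\<sigma> * (b / s)) *\<^sub>R \<phi> v + (\<sigma> * a^3 / s) *\<^sub>R \<xi>"
    by simp
  have "2 * k1 * k2 = g (- (k2 *\<^sub>R v) - k1 *\<^sub>R N) (- (k2 *\<^sub>R v) - k1 *\<^sub>R N)"
    using v N g_sym[of N v] by (simp add: g_simps)
  also have "\<dots> = \<sigma>\<^sup>2 * (b\<^sup>2 * a\<^sup>2 + a^6) / s\<^sup>2"
    unfolding DW' by (simp add: g_simps null_products[OF v] power_eq_if field_simps add_divide_distrib)
  also have "b\<^sup>2 * a\<^sup>2 + a^6 = s\<^sup>2 * a\<^sup>2"
    unfolding s(2) by (simp add: power_eq_if algebra_simps)
  finally show ?thesis
    using s(1) \<sigma> by simp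
qed

text \<open>This shows that the absolute value of the first curvature is the same for all Frenet frames.\<close>

lemma acceleration_norm:
  assumes "g v v = 0" "g v W = 0" "g W W = 1"
  shows "g (h *\<^sub>R v + k *\<^sub>R W) (h *\<^sub>R v + k *\<^sub>R W) = k\<^sup>2"
  using assms g_sym[of W v] by (simp add: g_simps power2_eq_square)

text \<open>The expansion of \<open>\<xi>\<close> in the frame is \<open>\<eta> N *\<^sub>R v + a *\<^sub>R N + \<eta> W *\<^sub>R W\<close>, and \<open>\<eta>\<close> is applied to it. That
  \<open>\<xi>\<close> lies in the span of the frame is obtained by eliminating \<open>\<phi> v\<close> from the given expressions of
  \<open>N\<close> and \<open>W\<close>; \<open>det\<close> is the coefficient with which \<open>\<xi>\<close> remains.\<close>

lemma xi_norm_in_frame: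
  assumes v: "g v v = 0" "\<eta> v = a" "g v (\<phi> v) = b"
    and W: "W = p *\<^sub>R \<xi> + c *\<^sub>R v + q *\<^sub>R \<phi> v" "g v W = 0" "g W W = 1"
    and N: "g v N = 1" "g N N = 0" "g N W = 0"
    and N_span: "N = \<alpha> *\<^sub>R v + \<beta> *\<^sub>R \<xi> + \<gamma> *\<^sub>R \<phi> v"
    and det: "q * \<beta> - p * \<gamma> \<noteq> 0"
  shows "1 = 2 * a * \<eta> N + (\<eta> W)\<^sup>2"
proof -
  define d where "d = q * \<beta> - p * \<gamma>"
  have "q *\<^sub>R N - \<gamma> *\<^sub>R W = (q * \<alpha> - \<gamma> * c) *\<^sub>R v + d *\<^sub>R \<xi>"
    unfolding N_span W(1) d_def by (simp add: algebra_simps)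
  then have "d *\<^sub>R \<xi> = q *\<^sub>R N - \<gamma> *\<^sub>R W - (q * \<alpha> - \<gamma> * c) *\<^sub>R v"
    by (simp add: algebra_simps)
  then have "\<xi> = (1 / d) *\<^sub>R (q *\<^sub>R N - \<gamma> *\<^sub>R W - (q * \<alpha> - \<gamma> * c) *\<^sub>R v)"
    using det unfolding d_def[symmetric] by (metis scaleR_one scaleR_scaleR divide_self times_divide_eq_left mult_1)
  then have "\<xi> = (- ((q * \<alpha> - \<gamma> * c) / d)) *\<^sub>R v + (q / d) *\<^sub>R N + (- (\<gamma> / d)) *\<^sub>R W"
    by (simp add: scaleR_diff_right)
  then obtain x y z where xi: "\<xi> = x *\<^sub>R v + y *\<^sub>R N + z *\<^sub>R W"
    by blast
  have "g v \<xi> = y" "g N \<xi> = x" "g W \<xi> = z"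
    unfolding xi using v W N g_sym[of W v] g_sym[of N v] g_sym[of W N] by (simp_all add: g_simps)
  then have "y = a" "x = \<eta> N" "z = \<eta> W"
    using v by (simp_all add: g_xi)
  moreover have "\<eta> \<xi> = x * \<eta> v + y * \<eta> N + z * \<eta> W"
    by (subst xi) (simp add: eta_simps)
  ultimately show ?thesis
    using v eta_xi by (simp add: power2_eq_square)
qed

end

section \<open>Covariant differentiation along a curve in one chart\<close>

text \<open>Product rule for a differentiable family of linear maps applied to a differentiable vector. It is
  the common source of the Leibniz rules for \<open>g\<close> and \<open>\<phi>\<close> along a curve: both are only known to be
  differentiable on fixed coordinate vectors. The summand \<open>F s (V t)\<close> of \<open>F s (V s)\<close> contributes \<open>F' (V t)\<close>, and the remaining
  \<open>F s (V s - V t)\<close>, expanded in a basis, has coefficients that vanish at \<open>t\<close>.\<close>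

lemma has_vector_derivative_linear_family:
  fixes F :: "real \<Rightarrow> 'a::euclidean_space \<Rightarrow> 'b::real_normed_vector"
  assumes "t \<in> J" and linear: "\<And>s. s \<in> J \<Longrightarrow> linear (F s)"
    and F: "\<And>X. ((\<lambda>s. F s X) has_vector_derivative F' X) (at t within J)"
    and V: "(V has_vector_derivative V') (at t within J)"
  shows "((\<lambda>s. F s (V s)) has_vector_derivative F' (V t) + F t V') (at t within J)"
proof -
  have expand: "F s X = (\<Sum>b\<in>Basis. (X \<bullet> b) *\<^sub>R F s b)" if "s \<in> J" for s X
  proof -
    have "F s X = F s (\<Sum>b\<in>Basis. (X \<bullet> b) *\<^sub>R b)"
      by (simp add: euclidean_representation)
    also have "\<dots> = (\<Sum>b\<in>Basis. (X \<bullet> b) *\<^sub>R F s b)"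
      using linear[OF that] by (simp add: linear_sum linear_scale)
    finally show ?thesis .
  qed
  have coord: "((\<lambda>s. (V s - V t) \<bullet> b) has_vector_derivative V' \<bullet> b) (at t within J)" for b
    using bounded_linear.has_vector_derivative[OF bounded_linear_inner_left[of b]
        has_vector_derivative_diff_const[THEN iffD2, OF V]] by simp
  have sum: "F s (V s) = F s (V t) + (\<Sum>b\<in>Basis. ((V s - V t) \<bullet> b) *\<^sub>R F s b)"
    if "s \<in> J" for s
    using linear[OF that] by (simp add: linear_diff flip: expand[OF that])
  have "((\<lambda>s. F s (V t) + (\<Sum>b\<in>Basis. ((V s - V t) \<bullet> b) *\<^sub>R F s b)) has_vector_derivative
      F' (V t) + (\<Sum>b\<in>Basis. ((V t - V t) \<bullet> b) *\<^sub>R F' b + (V' \<bullet> b) *\<^sub>R F t b)) (at t within J)"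
    by (intro has_vector_derivative_add has_vector_derivative_sum has_vector_derivative_scaleR F
        coord[unfolded has_real_derivative_iff_has_vector_derivative[symmetric]])
  from has_vector_derivative_transform[OF assms(1) sum this]
  show ?thesis
    by (simp flip: expand[OF assms(1)])
qed

text \<open>A Sasaki-like structure in coordinates. All computations with derivatives take place in this
  setting, where tangent vectors are elements of a Euclidean space.\<close>

locale sasaki_chart =
  fixes U :: "'a::euclidean_space set" and \<phi> :: "'a \<Rightarrow> 'a \<Rightarrow> 'a" and \<xi> :: "'a \<Rightarrow> 'a"
    and \<eta> :: "'a \<Rightarrow> 'a \<Rightarrow> real" and g :: "'a \<Rightarrow> 'a \<Rightarrow> 'a \<Rightarrow> real" and \<Gamma> :: "'a \<Rightarrow> 'a \<Rightarrow> 'a \<Rightarrow> 'a"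
  assumes B_metric: "x \<in> U \<Longrightarrow> B_metric_space (\<phi> x) (\<xi> x) (\<eta> x) (g x)"
    and phi_differentiable: "x \<in> U \<Longrightarrow> (\<lambda>y. \<phi> y X) differentiable (at x)"
    and xi_differentiable: "x \<in> U \<Longrightarrow> \<xi> differentiable (at x)"
    and g_differentiable: "x \<in> U \<Longrightarrow> (\<lambda>y. g y X Y) differentiable (at x)"
    and bilinear_Gamma: "x \<in> U \<Longrightarrow> bilinear (\<Gamma> x)"
    and metric_connection: "x \<in> U \<Longrightarrow> frechet_derivative (\<lambda>y. g y X Y) (at x) Z =
      g x (\<Gamma> x Z X) Y + g x X (\<Gamma> x Z Y)"
    and nabla_phi: "x \<in> U \<Longrightarrow> frechet_derivative (\<lambda>y. \<phi> y Y) (at x) X + \<Gamma> x X (\<phi> x Y) - \<phi> x (\<Gamma> x X Y) =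
      - (g x X Y *\<^sub>R \<xi> x) - \<eta> x Y *\<^sub>R X + (2 * \<eta> x X * \<eta> x Y) *\<^sub>R \<xi> x"

text \<open>Only the velocity at the parameter \<open>t\<close> is assumed to be the derivative of the curve; at other
  parameters \<open>v\<close> is an arbitrary family of vectors. The set \<open>J\<close> may have \<open>t\<close> as a boundary point, so all
  derivatives are taken within \<open>J\<close>.\<close>

locale curve_in_sasaki_chart = sasaki_chart U \<phi> \<xi> \<eta> g \<Gamma>
  for U :: "'a::euclidean_space set" and \<phi> \<xi> \<eta> g \<Gamma> +
  fixes J :: "real set" and x :: "real \<Rightarrow> 'a" and v :: "real \<Rightarrow> 'a" and t :: real
  assumes t: "t \<in> J" "at t within J \<noteq> bot" and x_U: "s \<in> J \<Longrightarrow> x s \<in> U"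
    and x_deriv: "(x has_vector_derivative v t) (at t within J)"
begin

text \<open>This is \<open>D = V' + \<Gamma> (x', V)\<close>, stated as a relation so that one fact carries both the
  differentiability of \<open>V\<close> and the value of its covariant derivative.\<close>

definition has_cov :: "(real \<Rightarrow> 'a) \<Rightarrow> 'a \<Rightarrow> bool" where
  "has_cov V D \<longleftrightarrow> (V has_vector_derivative D - \<Gamma> (x t) (v t) (V t)) (at t within J)"

sublocale B_metric_space "\<phi> (x t)" "\<xi> (x t)" "\<eta> (x t)" "g (x t)"
  by (rule B_metric[OF x_U[OF t(1)]])

lemmas Gamma_simps = 
  bilinear_radd[OF bilinear_Gamma[OF x_U[OF t(1)]]] bilinear_rmul[OF bilinear_Gamma[OF x_U[OF t(1)]]]
  bilinear_rzero[OF bilinear_Gamma[OF x_U[OF t(1)]]]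

lemma has_cov_unique:
  assumes "has_cov V D" "has_cov V D'"
  shows "D = D'"
  using vector_derivative_unique_within[OF t(2) assms[unfolded has_cov_def]] by simp

lemma has_cov_cong:
  assumes "has_cov V D" "\<And>s. s \<in> J \<Longrightarrow> V' s = V s"
  shows "has_cov V' D"
  using assms has_vector_derivative_transform[OF t(1), of V' V] t(1) by (simp add: has_cov_def)

lemma has_cov_add:
  assumes "has_cov V D" "has_cov V' D'"
  shows "has_cov (\<lambda>s. V s + V' s) (D + D')"
  using has_vector_derivative_add[OF assms[unfolded has_cov_def]]
  by (simp add: has_cov_def Gamma_simps algebra_simps)

lemma has_cov_scaleR:
  assumes "(p has_real_derivative p') (at t within J)" "has_cov V D"
  shows "has_cov (\<lambda>s. p s *\<^sub>R V s) (p' *\<^sub>R V t + p t *\<^sub>R D)"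
  using has_vector_derivative_scaleR[OF assms(1) assms(2)[unfolded has_cov_def]]
  by (simp add: has_cov_def Gamma_simps algebra_simps)

lemma chain_rule:
  assumes "h differentiable (at (x t))"
  shows "((\<lambda>s. h (x s)) has_vector_derivative frechet_derivative h (at (x t)) (v t)) (at t within J)"
  using vector_derivative_diff_chain_within[OF x_deriv has_derivative_at_withinI]
    assms[unfolded frechet_derivative_works] unfolding o_def .

lemma has_real_derivative_g:
  assumes V: "has_cov V D" and V': "has_cov V' D'"
  shows "((\<lambda>s. g (x s) (V s) (V' s)) has_real_derivative g (x t) D (V' t) + g (x t) (V t) D')
    (at t within J)"
proof -
  note inU = x_U[OF t(1)]
  have bilin: "bilinear (g (x s))" if "s \<in> J" for s
    using B_metric[OF x_U[OF that]] by (rule B_metric_space.bilinear_g)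
  have coord_deriv: "((\<lambda>s. g (x s) X Y) has_vector_derivative
      g (x t) (\<Gamma> (x t) (v t) X) Y + g (x t) X (\<Gamma> (x t) (v t) Y)) (at t within J)" for X Y
    using chain_rule[OF g_differentiable[OF inU]] by (simp add: metric_connection[OF inU])
  have lin: "linear (g (x s) X)" if "s \<in> J" for s X
    using bilin[OF that] by (simp add: bilinear_def)
  have "((\<lambda>s. g (x s) X (V' s)) has_vector_derivative
      (g (x t) (\<Gamma> (x t) (v t) X) (V' t) + g (x t) X (\<Gamma> (x t) (v t) (V' t)))
      + g (x t) X (D' - \<Gamma> (x t) (v t) (V' t))) (at t within J)" for X
    by (rule has_vector_derivative_linear_family[OF t(1) lin coord_deriv V'[unfolded has_cov_def]])
  then have "((\<lambda>s. g (x s) X (V' s)) has_vector_derivative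
      g (x t) (\<Gamma> (x t) (v t) X) (V' t) + g (x t) X D') (at t within J)" for X
    by (simp add: g_simps)
  moreover have "linear (\<lambda>X. g (x s) X (V' s))" if "s \<in> J" for s
    using bilin[OF that] by (simp add: bilinear_def)
  ultimately have "((\<lambda>s. g (x s) (V s) (V' s)) has_vector_derivative
      (g (x t) (\<Gamma> (x t) (v t) (V t)) (V' t) + g (x t) (V t) D')
      + g (x t) (D - \<Gamma> (x t) (v t) (V t)) (V' t)) (at t within J)"
    by (intro has_vector_derivative_linear_family[OF t(1) _ _ V[unfolded has_cov_def],
          where F = "\<lambda>s X. g (x s) X (V' s)"])
  then show ?thesis
    by (simp add: g_simps has_real_derivative_iff_has_vector_derivative add.commute)
qed

lemma has_cov_phi:
  assumes V: "has_cov V D"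
  shows "has_cov (\<lambda>s. \<phi> (x s) (V s)) (- (g (x t) (v t) (V t) *\<^sub>R \<xi> (x t)) - \<eta> (x t) (V t) *\<^sub>R v t
    + (2 * \<eta> (x t) (v t) * \<eta> (x t) (V t)) *\<^sub>R \<xi> (x t) + \<phi> (x t) D)"
proof -
  note inU = x_U[OF t(1)]
  have lin: "linear (\<phi> (x s))" if "s \<in> J" for s
    using B_metric[OF x_U[OF that]] by (rule B_metric_space.linear_phi)
  have "((\<lambda>s. \<phi> (x s) (V s)) has_vector_derivative
      frechet_derivative (\<lambda>y. \<phi> y (V t)) (at (x t)) (v t) + \<phi> (x t) (D - \<Gamma> (x t) (v t) (V t)))
      (at t within J)"
    by (rule has_vector_derivative_linear_family[OF t(1) lin chain_rule[OF phi_differentiable[OF inU]]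
          V[unfolded has_cov_def]])
  then show ?thesis
    unfolding has_cov_def nabla_phi[OF inU, symmetric] by (simp add: phi_simps algebra_simps)
qed

text \<open>In a Sasaki-like manifold \<open>\<nabla>\<^sub>X \<xi> = - \<phi> X\<close>. Differentiating \<open>\<phi> \<xi> = 0\<close> gives
  \<open>\<phi> (\<nabla>\<^sub>X \<xi> + \<phi> X) = 0\<close>, and differentiating \<open>g (\<xi>, \<xi>) = 1\<close> gives \<open>\<eta> (\<nabla>\<^sub>X \<xi>) = 0\<close>; a vector annihilated by
  both \<open>\<phi>\<close> and \<open>\<eta>\<close> vanishes.\<close>

lemma has_cov_xi: "has_cov (\<lambda>s. \<xi> (x s)) (- \<phi> (x t) (v t))"
proof -
  note inU = x_U[OF t(1)]
  define D where "D = frechet_derivative \<xi> (at (x t)) (v t) + \<Gamma> (x t) (v t) (\<xi> (x t))"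
  have D: "has_cov (\<lambda>s. \<xi> (x s)) D"
    using chain_rule[OF xi_differentiable[OF inU]] by (simp add: has_cov_def D_def)
  have "has_cov (\<lambda>s. \<phi> (x s) (\<xi> (x s))) 0"
    by (rule has_cov_cong[of "\<lambda>s. 0"])
      (simp_all add: has_cov_def Gamma_simps B_metric_space.phi_xi[OF B_metric[OF x_U]])
  from has_cov_unique[OF has_cov_phi[OF D] this]
  have "\<phi> (x t) (D + \<phi> (x t) (v t)) = 0"
    using scaleR_add_left[of "\<eta> (x t) (v t)" "\<eta> (x t) (v t)" "\<xi> (x t)"]
    by (simp add: g_xi eta_xi phi_simps phi_phi add.commute)
  moreover have "\<eta> (x t) (D + \<phi> (x t) (v t)) = 0"
  proof -
    have "((\<lambda>s. g (x s) (\<xi> (x s)) (\<xi> (x s))) has_real_derivative 0) (at t within J)"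
      unfolding has_real_derivative_iff_has_vector_derivative
      by (rule has_vector_derivative_transform[OF t(1) _ has_vector_derivative_const[of 1]])
        (simp add: B_metric_space.g_xi[OF B_metric[OF x_U]] B_metric_space.eta_xi[OF B_metric[OF x_U]])
    from vector_derivative_unique_within[OF t(2)
        this[unfolded has_real_derivative_iff_has_vector_derivative]
        has_real_derivative_g[OF D D, unfolded has_real_derivative_iff_has_vector_derivative]]
    have "g (x t) D (\<xi> (x t)) = 0"
      using g_sym[of D "\<xi> (x t)"] by simp
    then show ?thesis
      by (simp add: g_xi eta_simps eta_phi)
  qed
  ultimately have "D = - \<phi> (x t) (v t)"
    using phi_eq_0_imp[of "D + \<phi> (x t) (v t)"] by (simp add: add_eq_0_iff2)
  then show ?thesis
    using D by simp
qed

end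

section \<open>Slant null curves in one chart\<close>

context curve_in_sasaki_chart
begin

lemma has_cov_phi_v:
  assumes v: "g (x t) (v t) (v t) = 0" "\<eta> (x t) (v t) = a" and Dv: "has_cov v (k *\<^sub>R W)"
  shows "has_cov (\<lambda>s. \<phi> (x s) (v s))
    (- (a *\<^sub>R v t) + (2 * a\<^sup>2) *\<^sub>R \<xi> (x t) + k *\<^sub>R \<phi> (x t) W)"
  using has_cov_phi[OF Dv] v by (simp add: phi_simps power2_eq_square mult.assoc)

text \<open>The two scalar consequences of \<open>\<nabla> C' = k W\<close>: the derivatives of \<open>\<eta> C' = a\<close> and of
  \<open>b = g (C', \<phi> C')\<close>. The second also shows that \<open>b\<close> is differentiable.\<close>

lemma
  assumes v: "g (x t) (v t) (v t) = 0"
    and slant: "\<And>s. s \<in> J \<Longrightarrow> \<eta> (x s) (v s) = a"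
    and b: "\<And>s. s \<in> J \<Longrightarrow> b s = g (x s) (v s) (\<phi> (x s) (v s))"
    and Dv: "has_cov v (k *\<^sub>R W)"
  shows slant_acceleration: "k * \<eta> (x t) W = b t"
    and has_real_derivative_b:
      "(b has_real_derivative 2 * k * g (x t) W (\<phi> (x t) (v t)) + 2 * a^3) (at t within J)"
proof -
  note a = slant[OF t(1)] and bt = b[OF t(1)]
  have "((\<lambda>s. g (x s) (v s) (\<xi> (x s))) has_real_derivative 0) (at t within J)"
    unfolding has_real_derivative_iff_has_vector_derivative
    by (rule has_vector_derivative_transform[OF t(1) _ has_vector_derivative_const[of a]])
      (simp add: slant B_metric_space.g_xi[OF B_metric[OF x_U]])
  from vector_derivative_unique_within[OF t(2)
      this[unfolded has_real_derivative_iff_has_vector_derivative]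
      has_real_derivative_g[OF Dv has_cov_xi, unfolded has_real_derivative_iff_has_vector_derivative]]
  show "k * \<eta> (x t) W = b t"
    by (simp add: g_simps g_xi eta_simps bt)
  have "((\<lambda>s. g (x s) (v s) (\<phi> (x s) (v s))) has_real_derivative
      g (x t) (k *\<^sub>R W) (\<phi> (x t) (v t)) + g (x t) (v t)
        (- (a *\<^sub>R v t) + (2 * a\<^sup>2) *\<^sub>R \<xi> (x t) + k *\<^sub>R \<phi> (x t) W)) (at t within J)"
    by (rule has_real_derivative_g[OF Dv has_cov_phi_v[OF v a Dv]])
  also have "g (x t) (k *\<^sub>R W) (\<phi> (x t) (v t)) + g (x t) (v t)
        (- (a *\<^sub>R v t) + (2 * a\<^sup>2) *\<^sub>R \<xi> (x t) + k *\<^sub>R \<phi> (x t) W)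
      = 2 * k * g (x t) W (\<phi> (x t) (v t)) + 2 * a^3"
    using v a g_sym[of W "\<phi> (x t) (v t)"]
    by (simp add: g_simps g_xi phi_symmetric power2_eq_square power3_eq_cube)
  finally have "((\<lambda>s. g (x s) (v s) (\<phi> (x s) (v s))) has_real_derivative
      2 * k * g (x t) W (\<phi> (x t) (v t)) + 2 * a^3) (at t within J)" .
  from has_vector_derivative_transform[OF t(1) b
      this[unfolded has_real_derivative_iff_has_vector_derivative]]
  show "(b has_real_derivative 2 * k * g (x t) W (\<phi> (x t) (v t)) + 2 * a^3) (at t within J)"
    unfolding has_real_derivative_iff_has_vector_derivative .
qed

lemma has_cov_combination:
  assumes v: "g (x t) (v t) (v t) = 0" "\<eta> (x t) (v t) = a" and Dv: "has_cov v (k *\<^sub>R W t)"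
    and p: "(p has_real_derivative p') (at t within J)"
    and c: "(c has_real_derivative c') (at t within J)"
    and q: "(q has_real_derivative q') (at t within J)"
    and W: "\<And>s. s \<in> J \<Longrightarrow> W s = p s *\<^sub>R \<xi> (x s) + c s *\<^sub>R v s + q s *\<^sub>R \<phi> (x s) (v s)"
  shows "has_cov W (p' *\<^sub>R \<xi> (x t) + p t *\<^sub>R (- \<phi> (x t) (v t)) + (c' *\<^sub>R v t + c t *\<^sub>R k *\<^sub>R W t)
    + (q' *\<^sub>R \<phi> (x t) (v t)
       + q t *\<^sub>R (- (a *\<^sub>R v t) + (2 * a\<^sup>2) *\<^sub>R \<xi> (x t) + k *\<^sub>R \<phi> (x t) (W t))))"
  by (rule has_cov_cong[OF _ W])
    (intro has_cov_add has_cov_scaleR p c q has_cov_xi Dv has_cov_phi_v v)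

lemma curvature_product_if_b_constant:
  assumes v: "g (x t) (v t) (v t) = 0" "\<eta> (x t) (v t) = a" "g (x t) (v t) (\<phi> (x t) (v t)) = b"
    and Dv: "has_cov v (k1 *\<^sub>R W t)" and DW: "has_cov W (- (k2 *\<^sub>R v t) - k1 *\<^sub>R N)"
    and \<sigma>: "\<sigma>\<^sup>2 = 1" and r: "r > 0" "r\<^sup>2 = a^4 + b\<^sup>2" and k1: "k1 = - \<sigma> * r"
    and W: "\<And>s. s \<in> J \<Longrightarrow> W s = (\<sigma> * (- b / r)) *\<^sub>R \<xi> (x s) + (\<sigma> * (a / r)) *\<^sub>R \<phi> (x s) (v s)"
    and N: "g (x t) (v t) N = 1" "g (x t) N N = 0"
  shows "2 * k1 * k2 = a\<^sup>2"
proof (rule curvature_product_of_constant_b[OF v \<sigma> r k1 W[OF t(1)] _ N])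
  have "has_cov W ((\<sigma> * (- b / r)) *\<^sub>R (- \<phi> (x t) (v t))
      + (\<sigma> * (a / r)) *\<^sub>R (- (a *\<^sub>R v t) + (2 * a\<^sup>2) *\<^sub>R \<xi> (x t) + k1 *\<^sub>R \<phi> (x t) (W t)))"
    using has_cov_combination[where a = a and W = W and k = k1 and p = "\<lambda>s. \<sigma> * (- b / r)" and c = "\<lambda>s. 0"
        and q = "\<lambda>s. \<sigma> * (a / r)" and p' = 0 and c' = 0 and q' = 0, OF v(1,2) Dv] W
    by simp
  from has_cov_unique[OF DW this]
  show "- (k2 *\<^sub>R v t) - k1 *\<^sub>R N = (\<sigma> * (- b / r)) *\<^sub>R (- \<phi> (x t) (v t))
      + (\<sigma> * (a / r)) *\<^sub>R (- (a *\<^sub>R v t) + (2 * a\<^sup>2) *\<^sub>R \<xi> (x t) + k1 *\<^sub>R \<phi> (x t) (W t))" .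
qed

text \<open>The relation behind the rigidity statement. It contains \<open>b\<close> and \<open>b'\<close> but no second derivative of \<open>b\<close>,
  since it comes from differentiating only the function \<open>\<eta> W = b/k\<^sub>1\<close>. The Frenet equation for \<open>W\<close> gives
  \<open>b'/k\<^sub>1 = - k\<^sub>2 a - k\<^sub>1 \<eta> N - g (W, \<phi> C')\<close>, in which \<open>g (W, \<phi> C')\<close> is known from \<open>b'\<close> and \<open>\<eta> N\<close> from
  \<open>1 = 2 a \<eta> N + (\<eta> W)\<^sup>2\<close>. The latter needs \<open>N\<close> in the span of \<open>C'\<close>, \<open>\<xi>\<close>, \<open>\<phi> C'\<close>, which is read off from the Frenet
  equation after differentiating the expression for \<open>W\<close>.\<close>

lemma curvature_relation_if_k1_constant:
  assumes v: "g (x t) (v t) (v t) = 0"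
    and slant: "\<And>s. s \<in> J \<Longrightarrow> \<eta> (x s) (v s) = a" and a: "a \<noteq> 0"
    and b: "\<And>s. s \<in> J \<Longrightarrow> b s = g (x s) (v s) (\<phi> (x s) (v s))"
    and b': "(b has_real_derivative b') (at t within J)"
    and Dv: "has_cov v (k1 *\<^sub>R W t)" and DW: "has_cov W (- (k2 *\<^sub>R v t) - k1 *\<^sub>R N)"
    and k1: "k1 \<noteq> 0" "\<And>s. s \<in> J \<Longrightarrow> k1 * \<eta> (x s) (W s) = b s"
    and \<sigma>: "\<sigma>\<^sup>2 = 1"
    and W: "\<And>s. s \<in> J \<Longrightarrow> W s = \<sigma> *\<^sub>R ((- b s / sqrt (a^4 + (b s)\<^sup>2)) *\<^sub>R \<xi> (x s)
      + c s *\<^sub>R v s + (a / sqrt (a^4 + (b s)\<^sup>2)) *\<^sub>R \<phi> (x s) (v s))"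
    and frame: "g (x t) (v t) N = 1" "g (x t) N N = 0" "g (x t) N (W t) = 0"
      "g (x t) (v t) (W t) = 0" "g (x t) (W t) (W t) = 1"
  shows "3 * a * b' - 2 * a^4 = - 2 * k1 * k2 * a\<^sup>2 - k1\<^sup>2 + (b t)\<^sup>2"
proof -
  define r where "r s = sqrt (a^4 + (b s)\<^sup>2)" for s
  have u_pos: "a^4 + (b s)\<^sup>2 > 0" for s
    using a by (simp add: add_pos_nonneg)
  have r_pos: "r s > 0" for s
    using u_pos by (simp add: r_def)
  define p where "p s = \<sigma> * (- b s / r s)" for s
  define q where "q s = \<sigma> * (a / r s)" for s
  (* The coefficient of v in W involves b' and so need not look differentiable; but evaluating
     eta W = b / k1 expresses it through b alone. *)
  define f where "f s = (b s / k1 - p s) / a" for s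
  have W': "W s = p s *\<^sub>R \<xi> (x s) + (\<sigma> * c s) *\<^sub>R v s + q s *\<^sub>R \<phi> (x s) (v s)" if "s \<in> J" for s
    using W[OF that] by (simp add: r_def p_def q_def algebra_simps)
  have "\<sigma> * c s = f s" if s: "s \<in> J" for s
  proof -
    interpret s: B_metric_space "\<phi> (x s)" "\<xi> (x s)" "\<eta> (x s)" "g (x s)"
      by (rule B_metric[OF x_U[OF s]])
    have "\<eta> (x s) (W s) = p s + \<sigma> * c s * a"
      unfolding W'[OF s] using slant[OF s] by (simp add: s.eta_simps s.eta_xi s.eta_phi)
    then show ?thesis
      using k1(2)[OF s] k1(1) a by (simp add: f_def field_simps)
  qed
  then have Wf: "W s = p s *\<^sub>R \<xi> (x s) + f s *\<^sub>R v s + q s *\<^sub>R \<phi> (x s) (v s)" if "s \<in> J" for s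
    using W'[OF that] that by simp
  have r': "(r has_real_derivative inverse (r t) / 2 * (2 * b t * b')) (at t within J)"
  proof -
    have "((\<lambda>s. a^4 + (b s)\<^sup>2) has_real_derivative 2 * b t * b') (at t within J)"
      by (auto intro!: derivative_eq_intros b')
    from DERIV_chain2[OF DERIV_real_sqrt[OF u_pos] this]
    show ?thesis
      by (simp add: r_def[abs_def])
  qed
  have rt: "r t \<noteq> 0"
    using r_pos[of t] by simp
  obtain p' q' f' where deriv: "(p has_real_derivative p') (at t within J)"
    "(q has_real_derivative q') (at t within J)" "(f has_real_derivative f') (at t within J)"
  proof -
    note quot = DERIV_divide[OF _ r' rt]
    note p' = DERIV_cmult[OF quot[OF DERIV_minus[OF b']], of \<sigma>, folded p_def[abs_def]]
    note q' = DERIV_cmult[OF quot[OF DERIV_const[of a]], of \<sigma>, folded q_def[abs_def]]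
    note f' = DERIV_cdivide[OF DERIV_diff[OF DERIV_cdivide[OF b', of k1] p'], of a, folded f_def[abs_def]]
    show ?thesis
      by (rule that[OF p' q' f'])
  qed
  note at = slant[OF t(1)] and bt = b[OF t(1), symmetric] and Wt = Wf[OF t(1)]
  (* coordinates of k1 N with respect to v, xi and phi v, from the equation for the derivative of W *)
  define \<alpha> where "\<alpha> = - (k2 + f' + f t * k1 * f t - q t * a - k1 * (q t)\<^sup>2)"
  define \<beta> where "\<beta> = - (p' + f t * k1 * p t + 2 * a\<^sup>2 * q t + k1 * a * (q t)\<^sup>2)"
  define \<gamma> where "\<gamma> = - (- p t + f t * k1 * q t + q' + q t * k1 * f t)"
  have phi_W: "\<phi> (x t) (W t) = f t *\<^sub>R \<phi> (x t) (v t) + q t *\<^sub>R (- v t + a *\<^sub>R \<xi> (x t))"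
    unfolding Wt by (simp add: phi_simps phi_xi phi_phi at)
  have "k1 *\<^sub>R N = \<alpha> *\<^sub>R v t + \<beta> *\<^sub>R \<xi> (x t) + \<gamma> *\<^sub>R \<phi> (x t) (v t)"
  proof -
    have "k1 *\<^sub>R N = - (k2 *\<^sub>R v t) - (p' *\<^sub>R \<xi> (x t) + p t *\<^sub>R (- \<phi> (x t) (v t))
      + (f' *\<^sub>R v t + f t *\<^sub>R k1 *\<^sub>R W t) + (q' *\<^sub>R \<phi> (x t) (v t)
       + q t *\<^sub>R (- (a *\<^sub>R v t) + (2 * a\<^sup>2) *\<^sub>R \<xi> (x t) + k1 *\<^sub>R \<phi> (x t) (W t))))"
      using has_cov_unique[OF DW has_cov_combination[OF v at Dv deriv(1,3,2) Wf]]
      by (simp add: algebra_simps)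
    also have "\<dots> = - (k2 *\<^sub>R v t) - (p' *\<^sub>R \<xi> (x t) + p t *\<^sub>R (- \<phi> (x t) (v t))
      + (f' *\<^sub>R v t + f t *\<^sub>R k1 *\<^sub>R (p t *\<^sub>R \<xi> (x t) + f t *\<^sub>R v t + q t *\<^sub>R \<phi> (x t) (v t)))
      + (q' *\<^sub>R \<phi> (x t) (v t) + q t *\<^sub>R (- (a *\<^sub>R v t) + (2 * a\<^sup>2) *\<^sub>R \<xi> (x t)
         + k1 *\<^sub>R (f t *\<^sub>R \<phi> (x t) (v t) + q t *\<^sub>R (- v t + a *\<^sub>R \<xi> (x t))))))"
      unfolding phi_W by (simp only: Wt)
    also have "\<dots> = \<alpha> *\<^sub>R v t + \<beta> *\<^sub>R \<xi> (x t) + \<gamma> *\<^sub>R \<phi> (x t) (v t)"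
      by (simp add: \<alpha>_def \<beta>_def \<gamma>_def algebra_simps power2_eq_square)
        (simp flip: scaleR_add_left)
    finally show ?thesis .
  qed
  then have "(1 / k1) *\<^sub>R (k1 *\<^sub>R N) = (1 / k1) *\<^sub>R (\<alpha> *\<^sub>R v t + \<beta> *\<^sub>R \<xi> (x t) + \<gamma> *\<^sub>R \<phi> (x t) (v t))"
    by simp
  then have N: "N = (\<alpha> / k1) *\<^sub>R v t + (\<beta> / k1) *\<^sub>R \<xi> (x t) + (\<gamma> / k1) *\<^sub>R \<phi> (x t) (v t)"
    using k1(1) by (simp add: scaleR_add_right)
  have "1 = (\<beta> / k1) * a + (\<gamma> / k1) * b t"
    using frame(1) unfolding N using v by (simp add: g_simps g_xi at bt)
  then have "\<sigma> / r t = \<sigma> / r t * ((\<beta> / k1) * a + (\<gamma> / k1) * b t)"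
    by simp
  also have "\<dots> = q t * (\<beta> / k1) - p t * (\<gamma> / k1)"
    by (simp add: p_def q_def algebra_simps)
  finally have det: "q t * (\<beta> / k1) - p t * (\<gamma> / k1) \<noteq> 0"
    using rt \<sigma> by auto
  have norm: "1 = 2 * a * \<eta> (x t) N + (\<eta> (x t) (W t))\<^sup>2"
    by (rule xi_norm_in_frame[OF v at bt Wt frame(4,5,1-3) N det])
  have eta_W: "\<eta> (x t) (W t) = b t / k1"
    using k1(2)[OF t(1)] k1(1) by (simp add: field_simps)
  have "((\<lambda>s. g (x s) (W s) (\<xi> (x s))) has_vector_derivative b' / k1) (at t within J)"
  proof (rule has_vector_derivative_transform[OF t(1)])
    show "((\<lambda>s. b s / k1) has_vector_derivative b' / k1) (at t within J)"
      using DERIV_cdivide[OF b', of k1] by (simp add: has_real_derivative_iff_has_vector_derivative)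
    show "g (x s) (W s) (\<xi> (x s)) = b s / k1" if "s \<in> J" for s
      using k1(1) k1(2)[OF that] by (simp add: B_metric_space.g_xi[OF B_metric[OF x_U[OF that]]] field_simps)
  qed
  from vector_derivative_unique_within[OF t(2) this
      has_real_derivative_g[OF DW has_cov_xi, unfolded has_real_derivative_iff_has_vector_derivative]]
  have 1: "b' = k1 * (- (k2 * a) - k1 * \<eta> (x t) N - g (x t) (W t) (\<phi> (x t) (v t)))"
    using k1(1) by (simp add: g_simps g_xi eta_simps at field_simps)
  have 2: "b' = 2 * k1 * g (x t) (W t) (\<phi> (x t) (v t)) + 2 * a^3"
    using vector_derivative_unique_within[OF t(2)
        b'[unfolded has_real_derivative_iff_has_vector_derivative]
        has_real_derivative_b[OF v slant b Dv, unfolded has_real_derivative_iff_has_vector_derivative]] .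
  have 3: "k1\<^sup>2 * (2 * a * \<eta> (x t) N) = k1\<^sup>2 - (b t)\<^sup>2"
    using norm k1(1) unfolding eta_W by (simp add: field_simps)
  have "2 * a * b' = 2 * a * (k1 * (- (k2 * a) - k1 * \<eta> (x t) N - g (x t) (W t) (\<phi> (x t) (v t))))"
    using 1 by (rule arg_cong)
  also have "\<dots> = - 2 * k1 * k2 * a\<^sup>2 - k1\<^sup>2 * (2 * a * \<eta> (x t) N)
      - a * (2 * k1 * g (x t) (W t) (\<phi> (x t) (v t)))"
    by (simp add: algebra_simps power2_eq_square)
  also have "\<dots> = - 2 * k1 * k2 * a\<^sup>2 - k1\<^sup>2 + (b t)\<^sup>2 - a * (b' - 2 * a^3)"
    unfolding 3 using 2 by simp
  finally show ?thesis
    by (simp add: algebra_simps power_eq_if)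
qed

end

section \<open>Coordinate expressions of tensors on a manifold\<close>

abbreviation field_coord :: "('m \<Rightarrow> 'm tvec) \<Rightarrow> 'm chart \<Rightarrow> real^3 \<Rightarrow> real^3" where
  "field_coord \<xi> \<kappa> \<equiv> \<lambda>x. \<xi> (chart_inv \<kappa> x) \<kappa>"

abbreviation form_coord ::
  "'m atlas \<Rightarrow> ('m \<Rightarrow> 'm tvec \<Rightarrow> real) \<Rightarrow> 'm chart \<Rightarrow> real^3 \<Rightarrow> real^3 \<Rightarrow> real"
where
  "form_coord A \<eta> \<kappa> \<equiv> \<lambda>x X. \<eta> (chart_inv \<kappa> x) (tvec_of A \<kappa> (chart_inv \<kappa> x) X)"

lemma chart_inv_inverse:
  assumes "is_chart \<kappa>" "p \<in> fst \<kappa>"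
  shows "chart_inv \<kappa> (snd \<kappa> p) = p"
  using assms unfolding is_chart_def homeomorphism_def by blast

lemma chart_image_mem: "p \<in> fst \<kappa> \<Longrightarrow> snd \<kappa> p \<in> chart_image \<kappa>"
  by (simp add: chart_image_def)

lemma chart_inv_mem:
  assumes "x \<in> chart_image \<kappa>"
  shows "chart_inv \<kappa> x \<in> fst \<kappa>" "snd \<kappa> (chart_inv \<kappa> x) = x"
  using assms by (auto simp: chart_image_def chart_inv_def inv_into_into f_inv_into_f)

lemma open_chart_overlap:
  assumes "is_chart \<kappa>" "open V"
  shows "open (snd \<kappa> ` (fst \<kappa> \<inter> V))"
proof -
  have "openin (top_of_set (chart_image \<kappa>)) (snd \<kappa> ` (fst \<kappa> \<inter> V))"
    using assms homeomorphism_imp_open_map[of "fst \<kappa>" "chart_image \<kappa>" "snd \<kappa>" "chart_inv \<kappa>"]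
    by (auto simp: is_chart_def)
  then show ?thesis
    using assms openin_open_trans by (auto simp: is_chart_def)
qed

lemma Ck_on_imp_differentiable:
  assumes "Ck_on (Suc k) S f" "x \<in> S"
  shows "f differentiable (at x within S)"
  using assms by (simp add: differentiable_on_def)

lemma smooth_on_imp_differentiable:
  assumes "smooth_on S f" "x \<in> S"
  shows "f differentiable (at x within S)"
  using assms unfolding smooth_on_def by (blast intro: Ck_on_imp_differentiable[of 0])

lemma smooth_on_open_imp_differentiable:
  assumes "smooth_on S f" "open S" "x \<in> S"
  shows "f differentiable (at x)"
  using smooth_on_imp_differentiable[OF assms(1,3)] at_within_open[OF assms(3,2)] by simp

context
  fixes A :: "'m::{t2_space,second_countable_topology} atlas"
  assumes atlas: "smooth_atlas A"
begin

lemma charts_atD: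
  assumes "\<kappa> \<in> charts_at A p"
  shows "\<kappa> \<in> A" "p \<in> fst \<kappa>" "is_chart \<kappa>" "chart_inv \<kappa> (snd \<kappa> p) = p" "snd \<kappa> p \<in> chart_image \<kappa>"
  using assms atlas by (auto simp: charts_at_def smooth_atlas_def chart_inv_inverse chart_image_mem)

lemma transition_has_derivative:
  assumes "\<kappa> \<in> charts_at A p" "\<kappa>' \<in> charts_at A p"
  shows "(transition \<kappa> \<kappa>' has_derivative jac \<kappa> \<kappa>' p) (at (snd \<kappa> p))"
proof -
  note \<kappa> = charts_atD[OF assms(1)] and \<kappa>' = charts_atD[OF assms(2)]
  have "open (snd \<kappa> ` (fst \<kappa> \<inter> fst \<kappa>'))"
    using \<kappa>'(3) by (intro open_chart_overlap[OF \<kappa>(3)]) (simp add: is_chart_def)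
  moreover have "smooth_on (snd \<kappa> ` (fst \<kappa> \<inter> fst \<kappa>')) (transition \<kappa> \<kappa>')"
    using atlas \<kappa> \<kappa>' by (simp add: smooth_atlas_def)
  ultimately show ?thesis
    using smooth_on_open_imp_differentiable \<kappa>(2) \<kappa>'(2)
    unfolding jac_def by (metis IntI frechet_derivative_works imageI)
qed

lemma linear_jac:
  assumes "\<kappa> \<in> charts_at A p" "\<kappa>' \<in> charts_at A p"
  shows "linear (jac \<kappa> \<kappa>' p)"
  using transition_has_derivative[OF assms] by (rule has_derivative_linear)

lemma jac_self:
  assumes "\<kappa> \<in> charts_at A p"
  shows "jac \<kappa> \<kappa> p = id"
proof -
  note \<kappa> = charts_atD[OF assms]
  have "(transition \<kappa> \<kappa> has_derivative id) (at (snd \<kappa> p))"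
    by (rule has_derivative_transform_within_open[OF has_derivative_id[unfolded id_def[symmetric]]])
      (use \<kappa> in \<open>auto simp: is_chart_def transition_def chart_inv_mem\<close>)
  then show ?thesis
    using transition_has_derivative[OF assms assms] has_derivative_unique by blast
qed

text \<open>The cocycle law of the Jacobians, i.e. the chain rule for coordinate changes. It is what makes the
  family of vectors \<open>tvec_of A \<kappa> p X\<close> a tangent vector.\<close>

lemma jac_comp:
  assumes "\<kappa> \<in> charts_at A p" "\<kappa>' \<in> charts_at A p" "\<kappa>'' \<in> charts_at A p"
  shows "jac \<kappa>' \<kappa>'' p (jac \<kappa> \<kappa>' p X) = jac \<kappa> \<kappa>'' p X"
proof -
  note \<kappa> = charts_atD[OF assms(1)] and \<kappa>' = charts_atD[OF assms(2)] and \<kappa>'' = charts_atD[OF assms(3)]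
  have "transition \<kappa> \<kappa>' (snd \<kappa> p) = snd \<kappa>' p"
    using \<kappa> by (simp add: transition_def)
  with diff_chain_at[OF transition_has_derivative[OF assms(1,2)]] transition_has_derivative[OF assms(2,3)]
  have "(transition \<kappa>' \<kappa>'' \<circ> transition \<kappa> \<kappa>' has_derivative jac \<kappa>' \<kappa>'' p \<circ> jac \<kappa> \<kappa>' p) (at (snd \<kappa> p))"
    by simp
  moreover have "open (snd \<kappa> ` (fst \<kappa> \<inter> fst \<kappa>'))"
    using \<kappa>'(3) by (intro open_chart_overlap[OF \<kappa>(3)]) (simp add: is_chart_def)
  ultimately have "(transition \<kappa> \<kappa>'' has_derivative jac \<kappa>' \<kappa>'' p \<circ> jac \<kappa> \<kappa>' p) (at (snd \<kappa> p))"
    by (rule has_derivative_transform_within_open)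
      (use \<kappa> \<kappa>' in \<open>auto simp: transition_def chart_inv_inverse\<close>)
  then have "jac \<kappa>' \<kappa>'' p \<circ> jac \<kappa> \<kappa>' p = jac \<kappa> \<kappa>'' p"
    using transition_has_derivative[OF assms(1,3)] has_derivative_unique by blast
  then show ?thesis
    by (metis comp_apply)
qed

lemma tvec_of_mem:
  assumes "\<kappa> \<in> charts_at A p"
  shows "tvec_of A \<kappa> p X \<in> tangent_space A p"
  using jac_comp[OF assms] by (auto simp: tangent_space_def tvec_of_def)

lemma tvec_of_coord:
  assumes "\<kappa> \<in> charts_at A p"
  shows "tvec_of A \<kappa> p X \<kappa> = X"
  using assms jac_self by (simp add: tvec_of_def)

lemma tvec_of_tangent:
  assumes "\<kappa> \<in> charts_at A p" "X \<in> tangent_space A p"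
  shows "tvec_of A \<kappa> p (X \<kappa>) = X"
proof
  fix \<kappa>'
  have "X \<kappa>' = jac \<kappa> \<kappa>' p (X \<kappa>)" if "\<kappa>' \<in> charts_at A p"
    using assms that unfolding tangent_space_def by blast
  moreover have "X \<kappa>' = 0" if "\<kappa>' \<notin> charts_at A p"
    using assms that unfolding tangent_space_def by blast
  ultimately show "tvec_of A \<kappa> p (X \<kappa>) \<kappa>' = X \<kappa>'"
    by (simp add: tvec_of_def)
qed

lemma tvec_of_add:
  assumes "\<kappa> \<in> charts_at A p"
  shows "tvec_of A \<kappa> p (X + Y) = tvec_of A \<kappa> p X + tvec_of A \<kappa> p Y"
  using linear_jac[OF assms] by (auto simp: tvec_of_def linear_add)

lemma tvec_of_scaleR:
  assumes "\<kappa> \<in> charts_at A p"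
  shows "tvec_of A \<kappa> p (r *\<^sub>R X) = r *\<^sub>R tvec_of A \<kappa> p X"
  using linear_jac[OF assms] by (auto simp: tvec_of_def linear_scale scaleR_fun_def)

lemma linear_tvec_of:
  assumes \<kappa>: "\<kappa> \<in> charts_at A p" and f: "linear_on_subspace (tangent_space A p) f"
  shows "linear (\<lambda>X. f (tvec_of A \<kappa> p X))"
proof (rule linearI)
  fix X Y r
  note f' = f[unfolded linear_on_subspace_def, rule_format, OF tvec_of_mem[OF \<kappa>] tvec_of_mem[OF \<kappa>]]
  show "f (tvec_of A \<kappa> p (X + Y)) = f (tvec_of A \<kappa> p X) + f (tvec_of A \<kappa> p Y)"
    using f'[of 1 X 1 Y] by (simp add: tvec_of_add[OF \<kappa>])
  show "f (tvec_of A \<kappa> p (r *\<^sub>R X)) = r *\<^sub>R f (tvec_of A \<kappa> p X)"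
    using f'[of r X 0 X] by (simp add: tvec_of_scaleR[OF \<kappa>])
qed

end

context
  fixes A :: "'m::{t2_space,second_countable_topology} atlas"
    and \<phi> :: "'m \<Rightarrow> 'm tvec \<Rightarrow> 'm tvec" and \<xi> :: "'m \<Rightarrow> 'm tvec"
    and \<eta> :: "'m \<Rightarrow> 'm tvec \<Rightarrow> real" and g :: "'m \<Rightarrow> 'm tvec \<Rightarrow> 'm tvec \<Rightarrow> real"
  assumes manifold: "almost_contact_B_metric A \<phi> \<xi> \<eta> g"
begin

lemma manifold_atlas: "smooth_atlas A"
  using manifold by (simp add: almost_contact_B_metric_def)

lemma
  assumes \<kappa>: "\<kappa> \<in> charts_at A p"
  shows endo_coord_eq: "X \<in> tangent_space A p \<Longrightarrow> endo_coord A \<phi> \<kappa> (snd \<kappa> p) (X \<kappa>) = \<phi> p X \<kappa>"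
    and metric_coord_eq: "X \<in> tangent_space A p \<Longrightarrow> Y \<in> tangent_space A p \<Longrightarrow>
      metric_coord A g \<kappa> (snd \<kappa> p) (X \<kappa>) (Y \<kappa>) = g p X Y"
    and eta_coord_eq: "X \<in> tangent_space A p \<Longrightarrow> form_coord A \<eta> \<kappa> (snd \<kappa> p) (X \<kappa>) = \<eta> p X"
  using charts_atD[OF manifold_atlas \<kappa>] tvec_of_tangent[OF manifold_atlas \<kappa>]
  by (simp_all add: endo_coord_def metric_coord_def)

lemma endo_mem: "X \<in> tangent_space A p \<Longrightarrow> \<phi> p X \<in> tangent_space A p"
  using manifold by (auto simp: almost_contact_B_metric_def tangent_endomorphism_def)

lemma xi_mem: "\<xi> p \<in> tangent_space A p"
  using manifold by (auto simp: almost_contact_B_metric_def vector_field_def)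

text \<open>The tensors act on tangent vectors only; composing with \<open>tvec_of\<close>, which identifies the
  coordinate space of a chart with the tangent space, gives tensors on all of \<open>real^3\<close>.\<close>

lemma B_metric_space_coord:
  assumes \<kappa>: "\<kappa> \<in> charts_at A p"
  shows "B_metric_space (endo_coord A \<phi> \<kappa> (snd \<kappa> p)) (field_coord \<xi> \<kappa> (snd \<kappa> p))
    (form_coord A \<eta> \<kappa> (snd \<kappa> p)) (metric_coord A g \<kappa> (snd \<kappa> p))"
proof -
  note p [simp] = charts_atD(4)[OF manifold_atlas \<kappa>]
  note mem [simp] = tvec_of_mem[OF manifold_atlas \<kappa>]
  note coord [simp] = tvec_of_coord[OF manifold_atlas \<kappa>]
  note tangent [simp] = tvec_of_tangent[OF manifold_atlas \<kappa>]
  have endo: "tvec_of A \<kappa> p (endo_coord A \<phi> \<kappa> (snd \<kappa> p) X) = \<phi> p (tvec_of A \<kappa> p X)" for X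
    by (simp add: endo_coord_def endo_mem)
  have M: "linear_on_subspace (tangent_space A p) (\<phi> p)" "linear_on_subspace (tangent_space A p) (\<eta> p)"
    "X \<in> tangent_space A p \<Longrightarrow> linear_on_subspace (tangent_space A p) (g p X)"
    "X \<in> tangent_space A p \<Longrightarrow> Y \<in> tangent_space A p \<Longrightarrow> g p X Y = g p Y X"
    "\<eta> p (\<xi> p) = 1"
    "X \<in> tangent_space A p \<Longrightarrow> \<phi> p (\<phi> p X) = - X + \<eta> p X *\<^sub>R \<xi> p"
    "X \<in> tangent_space A p \<Longrightarrow> Y \<in> tangent_space A p \<Longrightarrow>
      g p (\<phi> p X) (\<phi> p Y) = - g p X Y + \<eta> p X * \<eta> p Y" for X Y
    using manifold
    by (simp_all add: almost_contact_B_metric_def tangent_endomorphism_def one_form_def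
        pseudo_riemannian_metric_def)
  have sym: "metric_coord A g \<kappa> (snd \<kappa> p) X Y = metric_coord A g \<kappa> (snd \<kappa> p) Y X" for X Y
    by (simp add: metric_coord_def M(4))
  have lin: "linear (metric_coord A g \<kappa> (snd \<kappa> p) X)" for X
    using linear_tvec_of[OF manifold_atlas \<kappa> M(3)[OF mem[of X]]] unfolding linear_iff by (simp add: metric_coord_def)
  show ?thesis
  proof (rule B_metric_space.intro)
    have "linear (\<lambda>X. \<phi> p (tvec_of A \<kappa> p X))"
      by (rule linear_tvec_of[OF manifold_atlas \<kappa> M(1)])
    then show "linear (endo_coord A \<phi> \<kappa> (snd \<kappa> p))"
      unfolding linear_iff by (simp add: endo_coord_def scaleR_fun_def)
    show "linear (form_coord A \<eta> \<kappa> (snd \<kappa> p))"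
      using linear_tvec_of[OF manifold_atlas \<kappa> M(2)] by simp
    show "bilinear (metric_coord A g \<kappa> (snd \<kappa> p))"
    proof -
      have "(\<lambda>X. metric_coord A g \<kappa> (snd \<kappa> p) X Y) = metric_coord A g \<kappa> (snd \<kappa> p) Y" for Y
        by (rule ext) (rule sym)
      then show ?thesis
        using lin by (simp add: bilinear_def)
    qed
    fix X Y :: "real^3"
    show "metric_coord A g \<kappa> (snd \<kappa> p) X Y = metric_coord A g \<kappa> (snd \<kappa> p) Y X"
      by (rule sym)
    show "form_coord A \<eta> \<kappa> (snd \<kappa> p) (field_coord \<xi> \<kappa> (snd \<kappa> p)) = 1"
      using M(5) by (simp add: xi_mem)
    show "metric_coord A g \<kappa> (snd \<kappa> p) (endo_coord A \<phi> \<kappa> (snd \<kappa> p) X) (endo_coord A \<phi> \<kappa> (snd \<kappa> p) Y)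
      = - metric_coord A g \<kappa> (snd \<kappa> p) X Y + form_coord A \<eta> \<kappa> (snd \<kappa> p) X * form_coord A \<eta> \<kappa> (snd \<kappa> p) Y"
      using M(7) by (simp add: metric_coord_def endo)
    have "endo_coord A \<phi> \<kappa> (snd \<kappa> p) (endo_coord A \<phi> \<kappa> (snd \<kappa> p) X) =
        \<phi> p (\<phi> p (tvec_of A \<kappa> p X)) \<kappa>"
      using endo by (simp add: endo_coord_def)
    then show "endo_coord A \<phi> \<kappa> (snd \<kappa> p) (endo_coord A \<phi> \<kappa> (snd \<kappa> p) X) =
      - X + form_coord A \<eta> \<kappa> (snd \<kappa> p) X *\<^sub>R field_coord \<xi> \<kappa> (snd \<kappa> p)"
      using M(6) by (simp add: scaleR_fun_def)
  qed
qed

lemma sasaki_chart_coord: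
  assumes connection: "levi_civita A g \<Gamma>" and sasaki: "sasaki_like A \<phi> \<xi> \<eta> g \<Gamma>" and \<kappa>: "\<kappa> \<in> A"
  shows "sasaki_chart (chart_image \<kappa>) (endo_coord A \<phi> \<kappa>) (field_coord \<xi> \<kappa>) (form_coord A \<eta> \<kappa>) (metric_coord A g \<kappa>) (\<Gamma> \<kappa>)"
proof (rule sasaki_chart.intro)
  fix x X Y Z :: "real^3" assume x: "x \<in> chart_image \<kappa>"
  define p where "p = chart_inv \<kappa> x"
  have p: "\<kappa> \<in> charts_at A p" "x = snd \<kappa> p"
    using \<kappa> x by (simp_all add: p_def chart_inv_mem charts_at_def)
  have U: "open (chart_image \<kappa>)"
    using charts_atD(3)[OF manifold_atlas p(1)] by (simp add: is_chart_def)
  have smooth: "smooth_on (chart_image \<kappa>) (\<lambda>x. endo_coord A \<phi> \<kappa> x X)"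
    "smooth_on (chart_image \<kappa>) (field_coord \<xi> \<kappa>)" "smooth_on (chart_image \<kappa>) (\<lambda>x. metric_coord A g \<kappa> x X Y)"
    using manifold \<kappa> by (simp_all add: almost_contact_B_metric_def tangent_endomorphism_def
        vector_field_def pseudo_riemannian_metric_def)
  show "B_metric_space (endo_coord A \<phi> \<kappa> x) (field_coord \<xi> \<kappa> x) (form_coord A \<eta> \<kappa> x) (metric_coord A g \<kappa> x)"
    unfolding p(2) by (rule B_metric_space_coord[OF p(1)])
  show "(\<lambda>y. endo_coord A \<phi> \<kappa> y X) differentiable at x" "(field_coord \<xi> \<kappa>) differentiable at x"
    "(\<lambda>y. metric_coord A g \<kappa> y X Y) differentiable at x"
    using smooth by (auto intro: smooth_on_open_imp_differentiable[OF _ U x])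
  show "bilinear (\<Gamma> \<kappa> x)"
    using connection \<kappa> x by (simp add: levi_civita_def affine_connection_def)
  show "frechet_derivative (\<lambda>y. metric_coord A g \<kappa> y X Y) (at x) Z =
      metric_coord A g \<kappa> x (\<Gamma> \<kappa> x Z X) Y + metric_coord A g \<kappa> x X (\<Gamma> \<kappa> x Z Y)"
    using connection \<kappa> x by (simp add: levi_civita_def)
  note [simp] = tvec_of_mem[OF manifold_atlas p(1)] tvec_of_coord[OF manifold_atlas p(1)] charts_atD(4)[OF manifold_atlas p(1)]
  have "nabla_endo A \<Gamma> \<phi> p (tvec_of A \<kappa> p X) (tvec_of A \<kappa> p Y) \<kappa> =
    (- (g p (tvec_of A \<kappa> p X) (tvec_of A \<kappa> p Y) *\<^sub>R \<xi> p) - \<eta> p (tvec_of A \<kappa> p Y) *\<^sub>R tvec_of A \<kappa> p X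
     + (2 * \<eta> p (tvec_of A \<kappa> p X) * \<eta> p (tvec_of A \<kappa> p Y)) *\<^sub>R \<xi> p) \<kappa>"
    using sasaki by (simp add: sasaki_like_def)
  then show "frechet_derivative (\<lambda>y. endo_coord A \<phi> \<kappa> y Y) (at x) X + \<Gamma> \<kappa> x X (endo_coord A \<phi> \<kappa> x Y)
      - endo_coord A \<phi> \<kappa> x (\<Gamma> \<kappa> x X Y) =
      - (metric_coord A g \<kappa> x X Y *\<^sub>R field_coord \<xi> \<kappa> x) - form_coord A \<eta> \<kappa> x Y *\<^sub>R X + (2 * form_coord A \<eta> \<kappa> x X * form_coord A \<eta> \<kappa> x Y) *\<^sub>R field_coord \<xi> \<kappa> x"
    using p(1) unfolding p(2) by (simp add: nabla_endo_def metric_coord_def scaleR_fun_def)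
qed

end

section \<open>Framed slant null curves on a manifold\<close>

text \<open>The parameters at which a curve stays in a chart form a relatively open set, so derivatives may
  be taken either within this set or within the whole interval.\<close>

lemma at_within_preimage:
  assumes "continuous_on I C" "open V" "t \<in> I" "C t \<in> V"
  shows "at t within {s \<in> I. C s \<in> V} = at t within I"
proof -
  have "{s \<in> I. C s \<in> V} = I \<inter> C -` V"
    by auto
  then obtain T where "open T" "{s \<in> I. C s \<in> V} = I \<inter> T"
    using continuous_openin_preimage_gen[OF assms(1,2)] openin_open by metis
  then show ?thesis
    using assms by (intro at_within_nhd[of t T]) auto
qed

lemma at_within_interval_neq_bot:
  fixes I :: "real set"
  assumes "is_interval I" "interior I \<noteq> {}" "t \<in> I"
  shows "at t within I \<noteq> bot"
proof -
  have "I \<noteq> {s}" for s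
    using assms(2) by auto
  then have "t islimpt I"
    using assms by (intro connected_imp_perfect) (auto simp: is_interval_connected)
  then show ?thesis
    by (simp add: trivial_limit_within)
qed

lemma frechet_derivative_1_eq_vector_derivative:
  fixes f :: "real \<Rightarrow> 'a::real_normed_vector"
  assumes "f differentiable (at t within J)" "at t within J \<noteq> bot"
  shows "frechet_derivative f (at t within J) 1 = vector_derivative f (at t within J)"
proof -
  have f: "(f has_derivative frechet_derivative f (at t within J)) (at t within J)"
    using assms(1) by (simp add: frechet_derivative_works)
  have "frechet_derivative f (at t within J) h = h *\<^sub>R frechet_derivative f (at t within J) 1" for h
    using linear_scale[OF has_derivative_linear[OF f], of h 1] by simp
  then have "(f has_vector_derivative frechet_derivative f (at t within J) 1) (at t within J)"
    unfolding has_vector_derivative_def using f by (metis (no_types, lifting) ext)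
  from vector_derivative_within[OF assms(2) this] show ?thesis
    by (rule sym)
qed

context
  fixes A :: "'m::{t2_space,second_countable_topology} atlas" and I C
  assumes atlas: "smooth_atlas A" and curve: "smooth_curve A I C"
begin

lemma curve_at_neq_bot: "t \<in> I \<Longrightarrow> at t within I \<noteq> bot"
  using curve at_within_interval_neq_bot by (auto simp: smooth_curve_def)

lemma at_within_chart_domain:
  assumes "t \<in> I" "\<kappa> \<in> charts_at A (C t)"
  shows "at t within {s \<in> I. C s \<in> fst \<kappa>} = at t within I"
  using assms curve charts_atD[OF atlas assms(2)]
  by (intro at_within_preimage) (auto simp: smooth_curve_def is_chart_def)

lemma has_vector_derivative_velocity:
  assumes t: "t \<in> I" and \<kappa>: "\<kappa> \<in> charts_at A (C t)"
  shows "((\<lambda>s. snd \<kappa> (C s)) has_vector_derivative velocity A I C t \<kappa>) (at t within I)"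
proof -
  have "smooth_on {s \<in> I. C s \<in> fst \<kappa>} (\<lambda>s. snd \<kappa> (C s))"
    using curve charts_atD[OF atlas \<kappa>] by (simp add: smooth_curve_def)
  from smooth_on_imp_differentiable[OF this, of t]
  have "(\<lambda>s. snd \<kappa> (C s)) differentiable (at t within I)"
    using t charts_atD(2)[OF atlas \<kappa>] at_within_chart_domain[OF t \<kappa>] by simp
  then show ?thesis
    using \<kappa> by (simp add: velocity_def vector_derivative_works)
qed

text \<open>Smoothness of the curve is a statement about iterated Frechet derivatives within the set of
  parameters that belong to the chart; on that set they agree with the velocity.\<close>

lemma velocity_differentiable:
  assumes t: "t \<in> I" and \<kappa>: "\<kappa> \<in> charts_at A (C t)"
  shows "(\<lambda>s. velocity A I C s \<kappa>) differentiable (at t within I)"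
proof -
  define J where "J = {s \<in> I. C s \<in> fst \<kappa>}"
  define x where "x s = snd \<kappa> (C s)" for s
  have "smooth_on J x"
    using curve charts_atD[OF atlas \<kappa>] by (simp add: smooth_curve_def J_def x_def[abs_def])
  then have "Ck_on (Suc (Suc 0)) J x"
    unfolding smooth_on_def by blast
  then have x: "x differentiable_on J" "Ck_on (Suc 0) J (\<lambda>s. frechet_derivative x (at s within J) 1)"
    unfolding Ck_on.simps(2)[of "Suc 0"] by blast+
  have tJ: "t \<in> J"
    using t charts_atD(2)[OF atlas \<kappa>] by (simp add: J_def)
  have vel: "frechet_derivative x (at s within J) 1 = velocity A I C s \<kappa>" if s: "s \<in> J" for s
  proof -
    have \<kappa>s: "\<kappa> \<in> charts_at A (C s)" and sI: "s \<in> I"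
      using s charts_atD(1)[OF atlas \<kappa>] by (auto simp: J_def charts_at_def)
    have at: "at s within J = at s within I"
      unfolding J_def by (rule at_within_chart_domain[OF sI \<kappa>s])
    have "frechet_derivative x (at s within J) 1 = vector_derivative x (at s within J)"
      using x(1) s curve_at_neq_bot[OF sI] unfolding at[symmetric]
      by (intro frechet_derivative_1_eq_vector_derivative) (simp_all add: differentiable_on_def)
    then show ?thesis
      using \<kappa>s at by (simp add: velocity_def x_def[abs_def])
  qed
  have "(\<lambda>s. velocity A I C s \<kappa>) differentiable (at t within J)"
    by (rule differentiable_transform_within[OF Ck_on_imp_differentiable[OF x(2) tJ] zero_less_one tJ vel])
  then show ?thesis
    using at_within_chart_domain[OF t \<kappa>] by (simp add: J_def)
qed

lemma velocity_mem:
  assumes t: "t \<in> I"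
  shows "velocity A I C t \<in> tangent_space A (C t)"
proof -
  have "velocity A I C t \<kappa>' = jac \<kappa> \<kappa>' (C t) (velocity A I C t \<kappa>)"
    if \<kappa>: "\<kappa> \<in> charts_at A (C t)" and \<kappa>': "\<kappa>' \<in> charts_at A (C t)" for \<kappa> \<kappa>'
  proof -
    have "((transition \<kappa> \<kappa>' \<circ> (\<lambda>s. snd \<kappa> (C s))) has_vector_derivative
        jac \<kappa> \<kappa>' (C t) (velocity A I C t \<kappa>)) (at t within I)"
      by (rule vector_derivative_diff_chain_within[OF has_vector_derivative_velocity[OF t \<kappa>]
            has_derivative_at_withinI[OF transition_has_derivative[OF atlas \<kappa> \<kappa>']]])
    then have "((transition \<kappa> \<kappa>' \<circ> (\<lambda>s. snd \<kappa> (C s))) has_vector_derivative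
        jac \<kappa> \<kappa>' (C t) (velocity A I C t \<kappa>)) (at t within {s \<in> I. C s \<in> fst \<kappa>})"
      by (simp only: at_within_chart_domain[OF t \<kappa>])
    then have "((\<lambda>s. snd \<kappa>' (C s)) has_vector_derivative
        jac \<kappa> \<kappa>' (C t) (velocity A I C t \<kappa>)) (at t within {s \<in> I. C s \<in> fst \<kappa>})"
    proof (rule has_vector_derivative_transform[rotated 2])
      show "t \<in> {s \<in> I. C s \<in> fst \<kappa>}"
        using t charts_atD(2)[OF atlas \<kappa>] by simp
      show "snd \<kappa>' (C s) = (transition \<kappa> \<kappa>' \<circ> (\<lambda>s. snd \<kappa> (C s))) s"
        if "s \<in> {s \<in> I. C s \<in> fst \<kappa>}" for s
        using that chart_inv_inverse[OF charts_atD(3)[OF atlas \<kappa>]] by (simp add: transition_def)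
    qed
    then have "((\<lambda>s. snd \<kappa>' (C s)) has_vector_derivative
        jac \<kappa> \<kappa>' (C t) (velocity A I C t \<kappa>)) (at t within I)"
      by (simp only: at_within_chart_domain[OF t \<kappa>])
    then show ?thesis
      by (rule vector_derivative_unique_within[OF curve_at_neq_bot[OF t]
            has_vector_derivative_velocity[OF t \<kappa>']])
  qed
  moreover have "velocity A I C t \<kappa> = 0" if "\<kappa> \<notin> charts_at A (C t)" for \<kappa>
    using that by (simp add: velocity_def)
  ultimately show ?thesis
    unfolding tangent_space_def by blast
qed

end

text \<open>The two signs of the frame enter only through their product \<open>\<sigma>\<close>.\<close>

locale framed_slant_null_curve =
  fixes A :: "'m::{t2_space,second_countable_topology} atlas"
    and \<phi> :: "'m \<Rightarrow> 'm tvec \<Rightarrow> 'm tvec" and \<xi> :: "'m \<Rightarrow> 'm tvec"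
    and \<eta> :: "'m \<Rightarrow> 'm tvec \<Rightarrow> real" and g :: "'m \<Rightarrow> 'm tvec \<Rightarrow> 'm tvec \<Rightarrow> real"
    and \<Gamma> :: "'m connection"
    and I :: "real set" and C :: "real \<Rightarrow> 'm" and N W :: "real \<Rightarrow> 'm tvec"
    and a :: real and b k1 k2 :: "real \<Rightarrow> real" and \<sigma> :: real
  assumes manifold: "almost_contact_B_metric A \<phi> \<xi> \<eta> g"
    and connection: "levi_civita A g \<Gamma>"
    and sasaki: "sasaki_like A \<phi> \<xi> \<eta> g \<Gamma>"
    and null_curve: "null_curve A g I C"
    and slant: "slant_curve A \<eta> I C a"
    and non_geodesic: "non_geodesic A g \<Gamma> I C"
    and b: "t \<in> I \<Longrightarrow> b t = g (C t) (velocity A I C t) (\<phi> (C t) (velocity A I C t))"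
    and \<sigma>: "\<sigma>\<^sup>2 = 1"
    and W: "t \<in> I \<Longrightarrow> W t = \<sigma> *\<^sub>R
        ((- b t / sqrt (a^4 + (b t)\<^sup>2)) *\<^sub>R \<xi> (C t)
         + (b t * vector_derivative b (at t within I) / (sqrt (a^4 + (b t)\<^sup>2) *
             (- 2 * (a^4 + (b t)\<^sup>2) + a * vector_derivative b (at t within I)))) *\<^sub>R velocity A I C t
         + (a / sqrt (a^4 + (b t)\<^sup>2)) *\<^sub>R \<phi> (C t) (velocity A I C t))"
    and framed: "framed_null_curve A g \<Gamma> I C N W k1 k2"
begin

abbreviation "vel \<equiv> velocity A I C"
abbreviation "b' t \<equiv> vector_derivative b (at t within I)"

lemmas atlas = manifold_atlas[OF manifold]

lemma smooth_curve: "smooth_curve A I C"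
  using null_curve by (simp add: null_curve_def)

lemmas vel_mem = velocity_mem[OF atlas smooth_curve]

lemma frame:
  assumes "t \<in> I"
  shows "N t \<in> tangent_space A (C t)" "W t \<in> tangent_space A (C t)"
    "g (C t) (vel t) (vel t) = 0" "\<eta> (C t) (vel t) = a"
    "g (C t) (vel t) (N t) = 1" "g (C t) (N t) (N t) = 0" "g (C t) (N t) (W t) = 0"
    "g (C t) (vel t) (W t) = 0" "g (C t) (W t) (W t) = 1"
    "nabla_along A \<Gamma> I C vel t = k1 t *\<^sub>R W t"
    "nabla_along A \<Gamma> I C W t = - (k2 t *\<^sub>R vel t) - k1 t *\<^sub>R N t"
  using assms framed slant
  by (simp_all add: framed_null_curve_def null_curve_def frenet_frame_def frenet_equations_def
      field_along_def slant_curve_def)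

lemma field_differentiable:
  assumes V: "field_along A I C V" and t: "t \<in> I" and \<kappa>: "\<kappa> \<in> charts_at A (C t)"
  shows "(\<lambda>s. V s \<kappa>) differentiable (at t within I)"
proof -
  have "smooth_on {s \<in> I. C s \<in> fst \<kappa>} (\<lambda>s. V s \<kappa>)"
    using V charts_atD(1)[OF atlas \<kappa>] by (simp add: field_along_def)
  from smooth_on_imp_differentiable[OF this, of t] show ?thesis
    using t charts_atD(2)[OF atlas \<kappa>] at_within_chart_domain[OF atlas smooth_curve t \<kappa>] by simp
qed

end

locale framed_slant_null_curve_in_chart = framed_slant_null_curve +
  fixes \<kappa> and t
  assumes t_I: "t \<in> I" and \<kappa>: "\<kappa> \<in> charts_at A (C t)"
begin

abbreviation "J \<equiv> {s \<in> I. C s \<in> fst \<kappa>}"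

lemma \<kappa>_J: "s \<in> J \<Longrightarrow> \<kappa> \<in> charts_at A (C s)"
  using charts_atD(1)[OF atlas \<kappa>] by (simp add: charts_at_def)

lemma at_J: "at t within J = at t within I"
  by (rule at_within_chart_domain[OF atlas smooth_curve t_I \<kappa>])

sublocale curve_in_sasaki_chart "chart_image \<kappa>" "endo_coord A \<phi> \<kappa>" "field_coord \<xi> \<kappa>"
  "form_coord A \<eta> \<kappa>" "metric_coord A g \<kappa>" "\<Gamma> \<kappa>" J "\<lambda>s. snd \<kappa> (C s)" "\<lambda>s. vel s \<kappa>" t
proof (rule curve_in_sasaki_chart.intro)
  show "sasaki_chart (chart_image \<kappa>) (endo_coord A \<phi> \<kappa>) (field_coord \<xi> \<kappa>)
      (form_coord A \<eta> \<kappa>) (metric_coord A g \<kappa>) (\<Gamma> \<kappa>)"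
    by (rule sasaki_chart_coord[OF manifold connection sasaki charts_atD(1)[OF atlas \<kappa>]])
  show "curve_in_sasaki_chart_axioms (chart_image \<kappa>) J (\<lambda>s. snd \<kappa> (C s)) (\<lambda>s. vel s \<kappa>) t"
  proof (rule curve_in_sasaki_chart_axioms.intro, unfold at_J)
    show "t \<in> J"
      using t_I charts_atD(2)[OF atlas \<kappa>] by simp
    show "at t within I \<noteq> bot"
      by (rule curve_at_neq_bot[OF atlas smooth_curve t_I])
    show "snd \<kappa> (C s) \<in> chart_image \<kappa>" if "s \<in> J" for s
      using that by (simp add: chart_image_mem)
    show "((\<lambda>s. snd \<kappa> (C s)) has_vector_derivative vel t \<kappa>) (at t within I)"
      by (rule has_vector_derivative_velocity[OF atlas smooth_curve t_I \<kappa>])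
  qed
qed

lemma coord:
  assumes "s \<in> J"
  shows "X \<in> tangent_space A (C s) \<Longrightarrow> Y \<in> tangent_space A (C s) \<Longrightarrow>
      metric_coord A g \<kappa> (snd \<kappa> (C s)) (X \<kappa>) (Y \<kappa>) = g (C s) X Y"
    and "X \<in> tangent_space A (C s) \<Longrightarrow> form_coord A \<eta> \<kappa> (snd \<kappa> (C s)) (X \<kappa>) = \<eta> (C s) X"
    and "endo_coord A \<phi> \<kappa> (snd \<kappa> (C s)) (vel s \<kappa>) = \<phi> (C s) (vel s) \<kappa>"
    and "field_coord \<xi> \<kappa> (snd \<kappa> (C s)) = \<xi> (C s) \<kappa>"
  using assms metric_coord_eq[OF manifold \<kappa>_J[OF assms]] eta_coord_eq[OF manifold \<kappa>_J[OF assms]]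
    endo_coord_eq[OF manifold \<kappa>_J[OF assms]] charts_atD(4)[OF atlas \<kappa>_J[OF assms]] vel_mem
  by simp_all

lemma has_cov_nabla_along:
  assumes "(\<lambda>s. V s \<kappa>) differentiable (at t within I)"
  shows "has_cov (\<lambda>s. V s \<kappa>) (nabla_along A \<Gamma> I C V t \<kappa>)"
  using assms \<kappa> unfolding has_cov_def at_J
  by (simp add: nabla_along_def vector_derivative_works)

lemma Dv: "has_cov (\<lambda>s. vel s \<kappa>) (k1 t *\<^sub>R W t \<kappa>)"
  using has_cov_nabla_along[where V = vel, OF velocity_differentiable[OF atlas smooth_curve t_I \<kappa>]] frame(10)[OF t_I]
  by (simp add: scaleR_fun_def)

lemma DW: "has_cov (\<lambda>s. W s \<kappa>) (- (k2 t *\<^sub>R vel t \<kappa>) - k1 t *\<^sub>R N t \<kappa>)"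
proof -
  have "field_along A I C W"
    using framed by (simp add: framed_null_curve_def frenet_frame_def)
  then show ?thesis
    using has_cov_nabla_along[where V = W, OF field_differentiable[where V = W, OF _ t_I \<kappa>]] frame(11)[OF t_I]
    by (simp add: scaleR_fun_def)
qed

lemma v_coord: "s \<in> J \<Longrightarrow> metric_coord A g \<kappa> (snd \<kappa> (C s)) (vel s \<kappa>) (vel s \<kappa>) = 0"
  "s \<in> J \<Longrightarrow> form_coord A \<eta> \<kappa> (snd \<kappa> (C s)) (vel s \<kappa>) = a"
  "s \<in> J \<Longrightarrow> b s = metric_coord A g \<kappa> (snd \<kappa> (C s)) (vel s \<kappa>)
    (endo_coord A \<phi> \<kappa> (snd \<kappa> (C s)) (vel s \<kappa>))"
  using coord frame vel_mem b endo_mem[OF manifold] by auto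

lemma W_coord:
  assumes "s \<in> J"
  shows "W s \<kappa> = \<sigma> *\<^sub>R
        ((- b s / sqrt (a^4 + (b s)\<^sup>2)) *\<^sub>R field_coord \<xi> \<kappa> (snd \<kappa> (C s))
         + (b s * b' s / (sqrt (a^4 + (b s)\<^sup>2) * (- 2 * (a^4 + (b s)\<^sup>2) + a * b' s))) *\<^sub>R vel s \<kappa>
         + (a / sqrt (a^4 + (b s)\<^sup>2)) *\<^sub>R endo_coord A \<phi> \<kappa> (snd \<kappa> (C s)) (vel s \<kappa>))"
  using W[of s] assms coord(3,4)[OF assms] by (simp add: scaleR_fun_def)

lemma frame_coord:
  "metric_coord A g \<kappa> (snd \<kappa> (C t)) (vel t \<kappa>) (N t \<kappa>) = 1"
  "metric_coord A g \<kappa> (snd \<kappa> (C t)) (N t \<kappa>) (N t \<kappa>) = 0"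
  "metric_coord A g \<kappa> (snd \<kappa> (C t)) (N t \<kappa>) (W t \<kappa>) = 0"
  "metric_coord A g \<kappa> (snd \<kappa> (C t)) (vel t \<kappa>) (W t \<kappa>) = 0"
  "metric_coord A g \<kappa> (snd \<kappa> (C t)) (W t \<kappa>) (W t \<kappa>) = 1"
  using coord(1)[OF t(1)] frame[OF t_I] vel_mem[OF t_I] by simp_all

text \<open>Being non-geodesic is witnessed by some other Frenet frame; both frames have the same \<open>k\<^sub>1\<^sup>2\<close>, namely
  the square length of \<open>\<nabla> C'\<close>.\<close>

lemma k1_nonzero: "k1 t \<noteq> 0"
proof -
  obtain N0 W0 h0 k10 k20 where F: "frenet_frame A g I C N0 W0"
    "frenet_equations A \<Gamma> I C N0 W0 h0 k10 k20" "k10 t \<noteq> 0"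
    using non_geodesic t_I unfolding non_geodesic_def by blast
  have W0: "W0 t \<in> tangent_space A (C t)" "g (C t) (W0 t) (W0 t) = 1" "g (C t) (vel t) (W0 t) = 0"
    using F(1) t_I by (simp_all add: frenet_frame_def field_along_def)
  have "nabla_along A \<Gamma> I C vel t = h0 t *\<^sub>R vel t + k10 t *\<^sub>R W0 t"
    using F(2) t_I by (simp add: frenet_equations_def)
  then have "k1 t *\<^sub>R W t = h0 t *\<^sub>R vel t + k10 t *\<^sub>R W0 t"
    using frame(10)[OF t_I] by simp
  from fun_cong[OF this, of \<kappa>]
  have "0 *\<^sub>R vel t \<kappa> + k1 t *\<^sub>R W t \<kappa> = h0 t *\<^sub>R vel t \<kappa> + k10 t *\<^sub>R W0 t \<kappa>"
    by (simp add: scaleR_fun_def)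
  moreover have "metric_coord A g \<kappa> (snd \<kappa> (C t)) (W0 t \<kappa>) (W0 t \<kappa>) = 1"
    "metric_coord A g \<kappa> (snd \<kappa> (C t)) (vel t \<kappa>) (W0 t \<kappa>) = 0"
    using W0 coord(1)[OF t(1)] vel_mem[OF t_I] by simp_all
  ultimately have "(k1 t)\<^sup>2 = (k10 t)\<^sup>2"
    using acceleration_norm[OF v_coord(1)[OF t(1)] frame_coord(4,5), of 0 "k1 t"]
      acceleration_norm[OF v_coord(1)[OF t(1)], of "W0 t \<kappa>" "h0 t" "k10 t"] by simp
  then show ?thesis
    using F(3) by auto
qed

lemma acceleration: "k1 t * \<eta> (C t) (W t) = b t"
  using slant_acceleration[OF v_coord(1)[OF t(1)] v_coord(2,3) Dv] coord(2)[OF t(1) frame(2)[OF t_I]]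
  by simp

lemma b'_eq: "b' t = 2 * k1 t * metric_coord A g \<kappa> (snd \<kappa> (C t)) (W t \<kappa>)
    (endo_coord A \<phi> \<kappa> (snd \<kappa> (C t)) (vel t \<kappa>)) + 2 * a^3"
  and b_has_derivative: "(b has_real_derivative b' t) (at t within I)"
proof -
  note d = has_real_derivative_b[OF v_coord(1)[OF t(1)] v_coord(2,3) Dv]
  show "b' t = 2 * k1 t * metric_coord A g \<kappa> (snd \<kappa> (C t)) (W t \<kappa>)
    (endo_coord A \<phi> \<kappa> (snd \<kappa> (C t)) (vel t \<kappa>)) + 2 * a^3"
    using vector_derivative_within[OF t(2)
        d[unfolded has_real_derivative_iff_has_vector_derivative]] by (simp add: at_J)
  then show "(b has_real_derivative b' t) (at t within I)"
    using d by (simp add: at_J)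
qed

lemma first_curvature:
  "sqrt (a^4 + (b t)\<^sup>2) > 0"
  "2 * sqrt (a^4 + (b t)\<^sup>2) * k1 t = \<sigma> * (- 2 * (sqrt (a^4 + (b t)\<^sup>2))\<^sup>2 + a * b' t)"
proof -
  note * = v_coord(1)[OF t(1)] v_coord(2)[OF t(1)] v_coord(3)[OF t(1), symmetric] \<sigma> refl
    W_coord[OF t(1)] frame_coord(5) k1_nonzero _ b'_eq
  have d_eta: "k1 t * form_coord A \<eta> \<kappa> (snd \<kappa> (C t)) (W t \<kappa>) = b t"
    using acceleration coord(2)[OF t(1) frame(2)[OF t_I]] by simp
  show "sqrt (a^4 + (b t)\<^sup>2) > 0"
    by (rule first_curvature_of_slant_null_curve(1)[OF * ]) (rule d_eta)
  show "2 * sqrt (a^4 + (b t)\<^sup>2) * k1 t = \<sigma> * (- 2 * (sqrt (a^4 + (b t)\<^sup>2))\<^sup>2 + a * b' t)"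
    by (rule first_curvature_of_slant_null_curve(2)[OF * ]) (rule d_eta)
qed

lemma curvature_product:
  assumes "\<And>s. s \<in> I \<Longrightarrow> b s = \<beta>" "\<And>s. s \<in> I \<Longrightarrow> b' s = 0"
  shows "2 * k1 t * k2 t = a\<^sup>2"
proof (rule curvature_product_if_b_constant[OF v_coord(1)[OF t(1)] v_coord(2)[OF t(1)]
      v_coord(3)[OF t(1), symmetric] Dv DW \<sigma> first_curvature(1) _ _ _ frame_coord(1,2)])
  show "(sqrt (a^4 + (b t)\<^sup>2))\<^sup>2 = a^4 + (b t)\<^sup>2"
    by simp
  define r where "r = sqrt (a^4 + (b t)\<^sup>2)"
  have "2 * r * k1 t = 2 * r * (- \<sigma> * r)" "r \<noteq> 0"
    using first_curvature[folded r_def] assms(2)[OF t_I] by (simp_all add: power2_eq_square)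
  then show "k1 t = - \<sigma> * sqrt (a^4 + (b t)\<^sup>2)"
    unfolding r_def[symmetric] using mult_left_cancel[of "2 * r" "k1 t" "- \<sigma> * r"] by simp
  show "W s \<kappa> = (\<sigma> * (- b t / sqrt (a^4 + (b t)\<^sup>2))) *\<^sub>R field_coord \<xi> \<kappa> (snd \<kappa> (C s)) +
      (\<sigma> * (a / sqrt (a^4 + (b t)\<^sup>2))) *\<^sub>R endo_coord A \<phi> \<kappa> (snd \<kappa> (C s)) (vel s \<kappa>)" if "s \<in> J" for s
    using W_coord[OF that] that assms t_I by (simp add: scaleR_add_right)
qed

text \<open>The hypothesis \<open>acc\<close> is \<open>acceleration\<close> at all parameters of the interval: the relation is
  obtained by differentiating it at \<open>t\<close>.\<close>

lemma curvature_relation: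
  assumes "\<And>s. s \<in> I \<Longrightarrow> k1 s = k1 t" "a \<noteq> 0" and acc: "\<And>s. s \<in> I \<Longrightarrow> k1 s * \<eta> (C s) (W s) = b s"
  shows "3 * a * b' t - 2 * a^4 = - 2 * k1 t * k2 t * a\<^sup>2 - (k1 t)\<^sup>2 + (b t)\<^sup>2"
proof (rule curvature_relation_if_k1_constant[OF v_coord(1)[OF t(1)] v_coord(2) assms(2)
      v_coord(3) _ Dv DW k1_nonzero _ \<sigma> W_coord frame_coord])
  show "(b has_real_derivative b' t) (at t within J)"
    unfolding at_J by (rule b_has_derivative)
  show "k1 t * form_coord A \<eta> \<kappa> (snd \<kappa> (C s)) (W s \<kappa>) = b s" if "s \<in> J" for s
    using acc[of s] assms(1)[of s] that coord(2)[OF that] frame(2)[of s] by simp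
qed

end

section \<open>Constancy of the curvatures\<close>

text \<open>A continuous function on a connected set with finitely many values is constant.\<close>

lemma constant_on_if_root_of_polynomial:
  fixes b :: "real \<Rightarrow> real"
  assumes "connected I" "continuous_on I b" "p \<noteq> 0" "\<And>t. t \<in> I \<Longrightarrow> poly p (b t) = 0"
  shows "b constant_on I"
proof (rule continuous_finite_range_constant[OF assms(1,2)])
  have "b ` I \<subseteq> {r. poly p r = 0}"
    using assms(4) by auto
  then show "finite (b ` I)"
    using poly_roots_finite[OF assms(3)] finite_subset by blast
qed

context framed_slant_null_curve
begin

lemma in_chart:
  assumes "t \<in> I"
  obtains \<kappa> where "framed_slant_null_curve_in_chart A \<phi> \<xi> \<eta> g \<Gamma> I C N W a b k1 k2 \<sigma> \<kappa> t"
proof -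
  have "C t \<in> (\<Union>\<kappa>\<in>A. fst \<kappa>)"
    using atlas by (simp add: smooth_atlas_def)
  then obtain \<kappa> where "\<kappa> \<in> charts_at A (C t)"
    by (auto simp: charts_at_def)
  with assms show ?thesis
    by (intro that) unfold_locales
qed

lemma curvature_facts:
  assumes "t \<in> I"
  shows "k1 t \<noteq> 0" "k1 t * \<eta> (C t) (W t) = b t"
    "(b has_real_derivative b' t) (at t within I)" "sqrt (a^4 + (b t)\<^sup>2) > 0"
    "2 * sqrt (a^4 + (b t)\<^sup>2) * k1 t = \<sigma> * (- 2 * (sqrt (a^4 + (b t)\<^sup>2))\<^sup>2 + a * b' t)"
proof -
  obtain \<kappa> where "framed_slant_null_curve_in_chart A \<phi> \<xi> \<eta> g \<Gamma> I C N W a b k1 k2 \<sigma> \<kappa> t"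
    using in_chart[OF assms] .
  then interpret framed_slant_null_curve_in_chart A \<phi> \<xi> \<eta> g \<Gamma> I C N W a b k1 k2 \<sigma> \<kappa> t .
  show "k1 t \<noteq> 0" "k1 t * \<eta> (C t) (W t) = b t"
    "(b has_real_derivative b' t) (at t within I)" "sqrt (a^4 + (b t)\<^sup>2) > 0"
    "2 * sqrt (a^4 + (b t)\<^sup>2) * k1 t = \<sigma> * (- 2 * (sqrt (a^4 + (b t)\<^sup>2))\<^sup>2 + a * b' t)"
    by (rule k1_nonzero acceleration b_has_derivative first_curvature)+
qed

lemma curvatures_if_b_constant:
  assumes b_const: "\<And>s. s \<in> I \<Longrightarrow> b s = \<beta>" and t: "t \<in> I"
  shows "k1 t = \<sigma> * (- sqrt (a^4 + \<beta>\<^sup>2))" "k2 t = \<sigma> * (- (a\<^sup>2 / (2 * sqrt (a^4 + \<beta>\<^sup>2))))"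
proof -
  have b'_0: "b' s = 0" if s: "s \<in> I" for s
    by (rule vector_derivative_within[OF curve_at_neq_bot[OF atlas smooth_curve s]
          has_vector_derivative_transform[OF s b_const has_vector_derivative_const]])
  define r where "r = sqrt (a^4 + \<beta>\<^sup>2)"
  have r: "r > 0" "2 * r * k1 t = 2 * r * (\<sigma> * (- r))"
    using curvature_facts(4,5)[OF t, unfolded b_const[OF t] b'_0[OF t], folded r_def]
    by (simp_all add: power2_eq_square)
  then have k1: "k1 t = \<sigma> * (- r)"
    using mult_left_cancel[of "2 * r" "k1 t" "\<sigma> * (- r)"] by simp
  then show "k1 t = \<sigma> * (- sqrt (a^4 + \<beta>\<^sup>2))"
    by (simp add: r_def)
  obtain \<kappa> where "framed_slant_null_curve_in_chart A \<phi> \<xi> \<eta> g \<Gamma> I C N W a b k1 k2 \<sigma> \<kappa> t"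
    using in_chart[OF t] .
  then have "2 * k1 t * k2 t = a\<^sup>2"
    using framed_slant_null_curve_in_chart.curvature_product b_const b'_0 by blast
  then have "\<sigma> * (- 2 * (\<sigma> * r) * k2 t) = \<sigma> * a\<^sup>2"
    unfolding k1 by simp
  moreover have "\<sigma> * (- 2 * (\<sigma> * r) * k2 t) = - 2 * r * k2 t"
    using \<sigma> by (simp add: power2_eq_square flip: mult.assoc) 
  ultimately show "k2 t = \<sigma> * (- (a\<^sup>2 / (2 * sqrt (a^4 + \<beta>\<^sup>2))))"
    unfolding r_def[symmetric] using r(1) by (simp add: field_simps)
qed

text \<open>With \<open>K = \<sigma> k\<^sub>1\<close>, the first curvature gives \<open>a b' = 2 s\<^sup>2 + 2 K s\<close>. For \<open>a = 0\<close> this says \<open>s = - K\<close> with \<open>s\<^sup>2 = b\<^sup>2\<close>.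
  For \<open>a \<noteq> 0\<close>, inserting it in the curvature relation and using \<open>b\<^sup>2 = s\<^sup>2 - a\<^sup>4\<close> gives
  \<open>5 s\<^sup>2 + 6 K s = M\<close> with constant \<open>M\<close>. Isolating the linear term and squaring removes the root and leaves
  an equation of degree four for \<open>b\<close> with leading coefficient \<open>25\<close>. In both cases all values of \<open>b\<close> are roots of one
  nonzero polynomial.\<close>

lemma b_constant_if_curvatures_constant:
  assumes "\<And>t. t \<in> I \<Longrightarrow> k1 t = K1" "\<And>t. t \<in> I \<Longrightarrow> k2 t = K2"
  shows "b constant_on I"
proof -
  have "connected I"
    using smooth_curve by (auto simp: smooth_curve_def is_interval_connected)
  moreover have "continuous_on I b"
    by (rule DERIV_continuous_on[OF curvature_facts(3)])
  moreover obtain p where "p \<noteq> 0" "\<And>t. t \<in> I \<Longrightarrow> poly p (b t) = 0"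
  proof (cases "a = 0")
    case True
    have "(b t)\<^sup>2 = K1\<^sup>2" if t: "t \<in> I" for t
    proof -
      have r: "sqrt (a^4 + (b t)\<^sup>2) = \<bar>b t\<bar>"
        using True by simp
      have "2 * \<bar>b t\<bar> * K1 = 2 * \<bar>b t\<bar> * (- \<sigma> * \<bar>b t\<bar>)" "\<bar>b t\<bar> \<noteq> 0"
        using curvature_facts(4,5)[OF t, unfolded r assms(1)[OF t] True]
        by (simp_all add: power2_eq_square)
      then have "K1 = - \<sigma> * \<bar>b t\<bar>"
        using mult_left_cancel[of "2 * \<bar>b t\<bar>" K1 "- \<sigma> * \<bar>b t\<bar>"] by simp
      then show ?thesis
        using \<sigma> by (simp add: power_mult_distrib)
    qed
    then show ?thesis
      by (intro that[of "[:- (K1\<^sup>2), 0, 1:]"]) (simp_all add: power2_eq_square)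
  next
    case False
    define K M where "K = \<sigma> * K1" and "M = a^4 - 2 * K1 * K2 * a\<^sup>2 - K1\<^sup>2"
    have eq: "(5 * (a^4 + (b t)\<^sup>2) - M)\<^sup>2 = 36 * K\<^sup>2 * (a^4 + (b t)\<^sup>2)" if t: "t \<in> I" for t
    proof -
      define r where "r = sqrt (a^4 + (b t)\<^sup>2)"
      have r2: "r\<^sup>2 = a^4 + (b t)\<^sup>2"
        by (simp add: r_def)
      have "\<sigma> * (2 * r * K1) = \<sigma>\<^sup>2 * (- 2 * r\<^sup>2 + a * b' t)"
        using curvature_facts(5)[OF t] assms(1)[OF t] by (simp add: r_def power2_eq_square)
      then have ab': "a * b' t = 2 * r\<^sup>2 + 2 * K * r"
        using \<sigma> by (simp add: K_def algebra_simps)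
      obtain \<kappa> where "framed_slant_null_curve_in_chart A \<phi> \<xi> \<eta> g \<Gamma> I C N W a b k1 k2 \<sigma> \<kappa> t"
        using in_chart[OF t] .
      from framed_slant_null_curve_in_chart.curvature_relation[OF this _ False curvature_facts(2)]
      have "3 * a * b' t - 2 * a^4 = - 2 * K1 * K2 * a\<^sup>2 - K1\<^sup>2 + (b t)\<^sup>2"
        using assms t by simp
      then have "5 * r\<^sup>2 - M = - 6 * K * r"
        using ab' r2 by (simp add: M_def algebra_simps)
      then have "(5 * r\<^sup>2 - M)\<^sup>2 = 36 * K\<^sup>2 * r\<^sup>2"
        by (simp add: power_mult_distrib)
      then show ?thesis
        unfolding r2 .
    qed
    define p where "p = [:(5 * a^4 - M)\<^sup>2 - 36 * K\<^sup>2 * a^4, 0, 10 * (5 * a^4 - M) - 36 * K\<^sup>2, 0, 25:]"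
    have "poly p (b t) = (5 * (a^4 + (b t)\<^sup>2) - M)\<^sup>2 - 36 * K\<^sup>2 * (a^4 + (b t)\<^sup>2)" for t
      by (simp add: p_def algebra_simps power2_eq_square)
    then show ?thesis
      using eq by (intro that[of p]) (simp_all add: p_def)
  qed
  ultimately show ?thesis
    by (rule constant_on_if_root_of_polynomial)
qed

end

theorem theorem3p11:
  fixes A :: "'m::{t2_space,second_countable_topology} atlas"
    and \<phi> :: "'m \<Rightarrow> 'm tvec \<Rightarrow> 'm tvec" and \<xi> :: "'m \<Rightarrow> 'm tvec"
    and \<eta> :: "'m \<Rightarrow> 'm tvec \<Rightarrow> real" and g :: "'m \<Rightarrow> 'm tvec \<Rightarrow> 'm tvec \<Rightarrow> real"
    and \<Gamma> :: "'m connection"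
    and I :: "real set" and C :: "real \<Rightarrow> 'm" and N W :: "real \<Rightarrow> 'm tvec"
    and a :: real and b k1 k2 :: "real \<Rightarrow> real" and \<epsilon> \<epsilon>1 :: real
  assumes manifold: "almost_contact_B_metric A \<phi> \<xi> \<eta> g"
    and connection: "levi_civita A g \<Gamma>"
    and sasaki: "sasaki_like A \<phi> \<xi> \<eta> g \<Gamma>"
    and curve: "null_curve A g I C" "slant_curve A \<eta> I C a" "non_geodesic A g \<Gamma> I C"
    and b: "\<forall>t\<in>I. b t = g (C t) (velocity A I C t) (\<phi> (C t) (velocity A I C t))"
    and b_C1: "Ck_on 1 I b"
    and signs: "\<epsilon> \<in> {1, -1}" "\<epsilon>1 \<in> {1, -1}"
    and W: "\<forall>t\<in>I. let s = sqrt (a^4 + (b t)^2); b' = vector_derivative b (at t within I) in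
      W t = (\<epsilon>1 * \<epsilon>) *\<^sub>R
        ((- b t / s) *\<^sub>R \<xi> (C t)
         + (b t * b' / (s * (- 2 * (a^4 + (b t)^2) + a * b'))) *\<^sub>R velocity A I C t
         + (a / s) *\<^sub>R \<phi> (C t) (velocity A I C t))"
    and framed: "framed_null_curve A g \<Gamma> I C N W k1 k2"
  shows "(k1 constant_on I \<and> k2 constant_on I \<longleftrightarrow> b constant_on I) \<and>
    (\<forall>\<beta>. (\<forall>t\<in>I. b t = \<beta>) \<longrightarrow>
      (\<forall>t\<in>I. k1 t = \<epsilon>1 * \<epsilon> * (- sqrt (a^4 + \<beta>^2)) \<and>
             k2 t = \<epsilon>1 * \<epsilon> * (- (a^2 / (2 * sqrt (a^4 + \<beta>^2))))))"
proof -
  have \<sigma>: "(\<epsilon>1 * \<epsilon>)\<^sup>2 = 1"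
    using signs by auto
  interpret framed_slant_null_curve A \<phi> \<xi> \<eta> g \<Gamma> I C N W a b k1 k2 "\<epsilon>1 * \<epsilon>"
    using manifold connection sasaki curve b \<sigma> W framed
    by (intro framed_slant_null_curve.intro) (simp_all add: Let_def)
  have curvatures: "k1 t = \<epsilon>1 * \<epsilon> * (- sqrt (a^4 + \<beta>^2)) \<and>
      k2 t = \<epsilon>1 * \<epsilon> * (- (a^2 / (2 * sqrt (a^4 + \<beta>^2))))"
    if "\<forall>s\<in>I. b s = \<beta>" "t \<in> I" for \<beta> t
    using curvatures_if_b_constant[of \<beta> t] that by blast
  moreover have "k1 constant_on I \<and> k2 constant_on I" if "b constant_on I"
    using that curvatures unfolding constant_on_def by meson
  moreover have "b constant_on I" if "k1 constant_on I" "k2 constant_on I"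
    using that b_constant_if_curvatures_constant unfolding constant_on_def by metis
  ultimately show ?thesis
    by blast
qed

end
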